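(* Let $W=\mathrm{diag}(w_1,\dots,w_{|\Lambda|})$ with $w_i>0$ and let $\lambda>0$. Let $\hat\psi_k=\hat\phi_k^\beta$ for some $0\le\beta\le1$, and suppose $$\mathcal R_{\Lambda,\lambda,W,1/2,1/2}:=\|(L_\phi+\lambda I)^{-1/2}(L_\phi-L_{\phi,\Lambda,W})(L_\phi+\lambda I)^{-1/2}\|_{\phi\to\phi}\le\tilde c<1/2$$ for some $\tilde c>0$. Then $$\mathcal Q_{\Lambda,\lambda,W}:=\|(L_\phi+\lambda I)^{1/2}(L_{\phi,\Lambda,W}+\lambda I)^{-1/2}\|_{\phi\to\phi}\le\sqrt{\frac1{1-\tilde c}},$$ $$\mathcal Q^*_{\Lambda,\lambda,W}:=\|(L_\phi+\lambda I)^{-1/2}(L_{\phi,\Lambda,W}+\lambda I)^{1/2}\|_{\phi\to\phi}\le\sqrt{\frac{1-\tilde c}{1-2\tilde c}},$$ and for all $f\in\mathcal N_\phi$, $$\|f\|_\psi\le\frac1{(1-\tilde c)^{(1-\beta)/2}}\lambda^{-\beta/2}\left(\lambda^{1/2}\|f\|_\phi+\|f\|_{\Lambda,W}\right),$$ $$\|f\|_{\Lambda,W}\le\sqrt{\frac{1-\tilde c}{1-2\tilde c}}\left(\|f\|_{L^2}+\lambda^{1/2}\|f\|_\phi\right),$$ where $\|f\|_{\Lambda,W}^2:=\sum_{i=1}^{|\Lambda|}w_i|f(x_i)|^2$.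
   Context: $\mathbb S^d\subset\mathbb R^{d+1}$ is the unit sphere, $d\omega$ the rotation-invariant measure with $\int_{\mathbb S^d}d\omega=1$, $L^2=L^2(\mathbb S^d,d\omega)$. $\{Y_{k,\ell}\}_{\ell=1}^{Z(d,k)}$ is an $L^2$-orthonormal basis of the spherical harmonics of degree $k$ (dimension $Z(d,k)$), $\hat f_{k,\ell}=\int fY_{k,\ell}d\omega$. A spherical basis function $\phi$ on $[-1,1]$ is given by $\phi(x\cdot x')=\sum_{k\ge0}\hat\phi_k\sum_\ell Y_{k,\ell}(x)Y_{k,\ell}(x')$ with $\hat\phi_k>0$, $\sum_k\hat\phi_kZ(d,k)<\infty$; $\phi_x(x')=\phi(x\cdot x')$. $\mathcal N_\phi$ is the Hilbert space of $f=\sum\hat f_{k,\ell}Y_{k,\ell}$ with $\|f\|_\phi^2=\sum_k\hat\phi_k^{-1}\sum_\ell\hat f_{k,\ell}^2<\infty$; it has reproducing kernel $\phi(x\cdot x')$. $\mathcal N_\psi$ and $\|\cdot\|_\psi$ are defined in the same way from $\hat\psi_k$ ($\mathcal N_\psi=L^2$ if $\beta=0$). $\Lambda=\{x_i\}_{i=1}^{|\Lambda|}\subset\mathbb S^d$ is a finite set of distinct points. On $\mathcal N_\phi$: $L_\phi f(x)=\int_{\mathbb S^d}f(x')\phi(x\cdot x')d\omega(x')$ and $L_{\phi,\Lambda,W}f=\sum_{i=1}^{|\Lambda|}w_if(x_i)\phi_{x_i}$, both positive self-adjoint operators. $\|\cdot\|_{\phi\to\phi}$ is the operator norm on $\mathcal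 N_\phi$. *)

theory Defs
  imports "HOL-Analysis.Analysis"
begin

text \<open>
  The ambient space of dimension $d+1$ is \<open>real ^ 'n\<close>. A real function on the unit sphere is
  represented by its extension by zero to \<open>real ^ 'n\<close>, so that equality of representatives is
  equality on the sphere.
\<close>

abbreviation usphere :: "(real ^ 'n) set" where
  "usphere \<equiv> sphere 0 1"

definition sphere_fun :: "((real ^ 'n) \<Rightarrow> real) \<Rightarrow> (real ^ 'n) \<Rightarrow> real" where
  "sphere_fun f = (\<lambda>x. if x \<in> usphere then f x else 0)"

definition rotation_invariant_prob :: "(real ^ 'n) measure \<Rightarrow> bool" where
  "rotation_invariant_prob \<omega> \<longleftrightarrow>
     emeasure \<omega> (space \<omega>) = 1 \<and> sets \<omega> = sets (restrict_space borel usphere) \<and>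
     (\<forall>Q. rotation_matrix Q \<longrightarrow> distr \<omega> \<omega> ((*v) Q) = \<omega>)"


subsection \<open>Spherical harmonics\<close>

definition laplacian :: "((real ^ 'n) \<Rightarrow> real) \<Rightarrow> (real ^ 'n) \<Rightarrow> real" where
  "laplacian p x = (\<Sum>i\<in>UNIV. (deriv ^^ 2) (\<lambda>t. p (x + t *\<^sub>R axis i 1)) 0)"

definition spherical_harmonics :: "nat \<Rightarrow> ((real ^ 'n) \<Rightarrow> real) set" where
  "spherical_harmonics k =
     {sphere_fun p | p. real_polynomial_function p \<and>
        (\<forall>c x. p (c *\<^sub>R x) = c ^ k * p x) \<and> (\<forall>x. laplacian p x = 0)}"

text \<open>
  For each degree \<open>k\<close>, the functions \<open>Y k 1, \<dots>, Y k (Z k)\<close> are an $L^2$-orthonormal basis of the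
  spherical harmonics of degree \<open>k\<close>; in particular \<open>Z k\<close> is the dimension of that space.
  Orthogonality between different degrees is a theorem and is not part of the definition.
\<close>

definition orthonormal_harmonic_bases ::
  "(real ^ 'n) measure \<Rightarrow> (nat \<Rightarrow> nat) \<Rightarrow> (nat \<Rightarrow> nat \<Rightarrow> (real ^ 'n) \<Rightarrow> real) \<Rightarrow> bool" where
  "orthonormal_harmonic_bases \<omega> Z Y \<longleftrightarrow>
     (\<forall>k. (\<forall>l\<in>{1..Z k}. Y k l \<in> spherical_harmonics k) \<and>
          (\<forall>l\<in>{1..Z k}. \<forall>l'\<in>{1..Z k}.
             (LINT x|\<omega>. Y k l x * Y k l' x) = (if l = l' then 1 else 0)) \<and>
          (\<forall>g\<in>spherical_harmonics k. \<exists>a. \<forall>x. g x = (\<Sum>l=1..Z k. a l * Y k l x)))"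


subsection \<open>Native spaces\<close>

definition L2_space :: "(real ^ 'n) measure \<Rightarrow> ((real ^ 'n) \<Rightarrow> real) set" where
  "L2_space \<omega> = {f. (\<forall>x. x \<notin> usphere \<longrightarrow> f x = 0) \<and> f \<in> borel_measurable \<omega> \<and>
                    integrable \<omega> (\<lambda>x. (f x)\<^sup>2)}"

definition L2norm :: "(real ^ 'n) measure \<Rightarrow> ((real ^ 'n) \<Rightarrow> real) \<Rightarrow> real" where
  "L2norm \<omega> f = sqrt (LINT x|\<omega>. (f x)\<^sup>2)"

context
  fixes \<omega> :: "(real ^ 'n) measure"
    and Z :: "nat \<Rightarrow> nat"
    and Y :: "nat \<Rightarrow> nat \<Rightarrow> (real ^ 'n) \<Rightarrow> real"
begin

definition fcoeff :: "((real ^ 'n) \<Rightarrow> real) \<Rightarrow> nat \<Rightarrow> nat \<Rightarrow> real" where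
  "fcoeff f k l = (LINT x|\<omega>. f x * Y k l x)"

definition native_inner ::
  "(nat \<Rightarrow> real) \<Rightarrow> ((real ^ 'n) \<Rightarrow> real) \<Rightarrow> ((real ^ 'n) \<Rightarrow> real) \<Rightarrow> real" where
  "native_inner c f g = (\<Sum>k. inverse (c k) * (\<Sum>l=1..Z k. fcoeff f k l * fcoeff g k l))"

definition native_norm :: "(nat \<Rightarrow> real) \<Rightarrow> ((real ^ 'n) \<Rightarrow> real) \<Rightarrow> real" where
  "native_norm c f = sqrt (\<Sum>k. inverse (c k) * (\<Sum>l=1..Z k. (fcoeff f k l)\<^sup>2))"

text \<open>
  In \<open>native_L2\<close> the expansion of \<open>f\<close> is understood in $L^2$, and a function may be changed on a
  null set; this covers the case \<open>c = (\<lambda>_. 1)\<close>, where the space is $L^2$. In \<open>native_fun\<close> the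
  expansion converges to \<open>f\<close> at every point of the sphere, which selects the representative of
  each class for which point evaluations are given by the reproducing kernel.
\<close>

definition native_L2 :: "(nat \<Rightarrow> real) \<Rightarrow> ((real ^ 'n) \<Rightarrow> real) set" where
  "native_L2 c = {f \<in> L2_space \<omega>.
     (\<lambda>K. L2norm \<omega> (\<lambda>x. f x - (\<Sum>k<K. \<Sum>l=1..Z k. fcoeff f k l * Y k l x))) \<longlonglongrightarrow> 0 \<and>
     summable (\<lambda>k. inverse (c k) * (\<Sum>l=1..Z k. (fcoeff f k l)\<^sup>2))}"

definition native_fun :: "(nat \<Rightarrow> real) \<Rightarrow> ((real ^ 'n) \<Rightarrow> real) set" where
  "native_fun c = {f \<in> native_L2 c.
     \<forall>x\<in>usphere. (\<lambda>k. \<Sum>l=1..Z k. fcoeff f k l * Y k l x) sums f x}"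

text \<open>
  The function \<open>\<phi>\<close> on \<open>[-1, 1]\<close> is determined by its values at inner products of points of the
  sphere.
\<close>

definition spherical_basis_function :: "(real \<Rightarrow> real) \<Rightarrow> (nat \<Rightarrow> real) \<Rightarrow> bool" where
  "spherical_basis_function \<phi> \<phi>h \<longleftrightarrow>
     (\<forall>k. \<phi>h k > 0) \<and> summable (\<lambda>k. \<phi>h k * real (Z k)) \<and>
     (\<forall>x\<in>usphere. \<forall>x'\<in>usphere.
        (\<lambda>k. \<phi>h k * (\<Sum>l=1..Z k. Y k l x * Y k l x')) sums \<phi> (x \<bullet> x'))"

end


subsection \<open>The integral operator, its discretization and the discrete seminorm\<close>

definition integral_op ::
  "(real ^ 'n) measure \<Rightarrow> (real \<Rightarrow> real) \<Rightarrow> ((real ^ 'n) \<Rightarrow> real) \<Rightarrow> (real ^ 'n) \<Rightarrow> real" where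
  "integral_op \<omega> \<phi> f = sphere_fun (\<lambda>x. LINT x'|\<omega>. f x' * \<phi> (x \<bullet> x'))"

definition discrete_op ::
  "(real \<Rightarrow> real) \<Rightarrow> nat \<Rightarrow> (nat \<Rightarrow> real ^ 'n) \<Rightarrow> (nat \<Rightarrow> real) \<Rightarrow>
    ((real ^ 'n) \<Rightarrow> real) \<Rightarrow> (real ^ 'n) \<Rightarrow> real" where
  "discrete_op \<phi> m x w f = sphere_fun (\<lambda>y. \<Sum>i=1..m. w i * f (x i) * \<phi> (x i \<bullet> y))"

definition discrete_norm ::
  "nat \<Rightarrow> (nat \<Rightarrow> real ^ 'n) \<Rightarrow> (nat \<Rightarrow> real) \<Rightarrow> ((real ^ 'n) \<Rightarrow> real) \<Rightarrow> real" where
  "discrete_norm m x w f = sqrt (\<Sum>i=1..m. w i * \<bar>f (x i)\<bar>\<^sup>2)"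


subsection \<open>Operators on a Hilbert space of functions\<close>

text \<open>
  The Hilbert space is given by a carrier \<open>H\<close> and an inner product \<open>ip\<close>; operators are functions
  whose values outside \<open>H\<close> are irrelevant.
\<close>

context
  fixes H :: "('a \<Rightarrow> real) set"
    and ip :: "('a \<Rightarrow> real) \<Rightarrow> ('a \<Rightarrow> real) \<Rightarrow> real"
begin

text \<open>The operator norm takes the value \<open>\<infinity>\<close> if the operator is unbounded.\<close>

definition op_norm :: "(('a \<Rightarrow> real) \<Rightarrow> 'a \<Rightarrow> real) \<Rightarrow> ennreal" where
  "op_norm T = (SUP f\<in>{f \<in> H. sqrt (ip f f) \<le> 1}. ennreal (sqrt (ip (T f) (T f))))"

definition positive_op :: "(('a \<Rightarrow> real) \<Rightarrow> 'a \<Rightarrow> real) \<Rightarrow> bool" where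
  "positive_op T \<longleftrightarrow>
     (\<forall>f\<in>H. T f \<in> H) \<and>
     (\<forall>f\<in>H. \<forall>g\<in>H. \<forall>a b. T (\<lambda>x. a * f x + b * g x) = (\<lambda>x. a * T f x + b * T g x)) \<and>
     op_norm T < \<infinity> \<and>
     (\<forall>f\<in>H. \<forall>g\<in>H. ip (T f) g = ip f (T g)) \<and>
     (\<forall>f\<in>H. ip (T f) f \<ge> 0)"

text \<open>The positive square root of a positive operator exists and is unique on \<open>H\<close>.\<close>

definition op_sqrt ::
  "(('a \<Rightarrow> real) \<Rightarrow> 'a \<Rightarrow> real) \<Rightarrow> ('a \<Rightarrow> real) \<Rightarrow> 'a \<Rightarrow> real" where
  "op_sqrt A = (SOME S. positive_op S \<and> (\<forall>f\<in>H. S (S f) = A f))"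

definition op_inv_sqrt ::
  "(('a \<Rightarrow> real) \<Rightarrow> 'a \<Rightarrow> real) \<Rightarrow> ('a \<Rightarrow> real) \<Rightarrow> 'a \<Rightarrow> real" where
  "op_inv_sqrt A = inv_into H (op_sqrt A)"

end

definition op_shift ::
  "(('a \<Rightarrow> real) \<Rightarrow> 'a \<Rightarrow> real) \<Rightarrow> real \<Rightarrow> ('a \<Rightarrow> real) \<Rightarrow> 'a \<Rightarrow> real" where
  "op_shift A lam f = (\<lambda>x. A f x + lam * f x)"

definition op_diff ::
  "(('a \<Rightarrow> real) \<Rightarrow> 'a \<Rightarrow> real) \<Rightarrow> (('a \<Rightarrow> real) \<Rightarrow> 'a \<Rightarrow> real) \<Rightarrow> ('a \<Rightarrow> real) \<Rightarrow> 'a \<Rightarrow> real" where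
  "op_diff A B f = (\<lambda>x. A f x - B f x)"

end

theory Submission
  imports Defs
begin

text \<open>
  Write $A = L_\phi + \lambda I$ and $B = L_{\phi,\Lambda,W} + \lambda I$. Everything follows from
  a comparison of the quadratic forms of $A$ and $B$ on the native space. Putting
  $g = A^{1/2} h$ in the hypothesis
  $\|A^{-1/2}(A - B)A^{-1/2}\| \le c$ gives $|\langle (A - B)h, h\rangle| \le c\,\langle Ah, h\rangle$,
  that is,
  $$(1 - c)\,\langle Ah, h\rangle \le \langle Bh, h\rangle \le (1 + c)\,\langle Ah, h\rangle ,
  \qquad 1 + c \le \frac{1 - c}{1 - 2c}.$$
  The two bounds on operator norms are these inequalities read at $h = B^{-1/2} f$, where
  $\langle Bh, h\rangle = \|f\|^2$ and $\langle Ah, h\rangle = \|A^{1/2} B^{-1/2} f\|^2$, and, for the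
  second one, after passing to the adjoint $B^{1/2} A^{-1/2}$.

  The two sampling inequalities come from the values of the forms:
  $\langle Af, f\rangle = \|f\|_{L^2}^2 + \lambda\|f\|_\phi^2$ by Parseval's identity and
  $\langle Bf, f\rangle = \|f\|_{\Lambda,W}^2 + \lambda\|f\|_\phi^2$ by the reproducing property. The
  norm $\|f\|_\psi$ interpolates between $\|f\|_{L^2}$ and $\|f\|_\phi$; the weighted inequality of
  arithmetic and geometric means, applied in each degree, yields
  $$e^{1-\beta}\lambda^\beta\,\|f\|_\psi^2 \le (1 - \beta)\,e\,\|f\|_{L^2}^2 + \beta\lambda\,\|f\|_\phi^2
  \qquad (e = 1 - c),$$
  and both $e\,\|f\|_{L^2}^2$ and $\lambda\|f\|_\phi^2$ are at most $\langle Bf, f\rangle$.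

  Two facts have to be in place for this argument. The positive square roots of $A$ and $B$ must exist and
  be bijective: \<open>contraction_sqrt_exists\<close> solves the equation $Y = (T + Y^2)/2$ by iteration,
  which makes $(I - Y)^2 = I - T$, and for this the native space has to be complete
  (\<open>native_complete\<close>). The description of the native space by Fourier coefficients, on which
  completeness, the reproducing property and Parseval's identity rest, requires harmonics of
  different degrees to be orthogonal for every rotation-invariant measure
  (\<open>homogeneous_harmonics_orthogonal\<close>); this is obtained from the invariance under plane
  rotations alone, in the form of a divergence theorem on the sphere.
\<close>

section \<open>Partial derivatives of polynomials\<close>

definition partial :: "'n \<Rightarrow> ((real ^ 'n) \<Rightarrow> real) \<Rightarrow> (real ^ 'n) \<Rightarrow> real" where
  "partial i p x = deriv (\<lambda>t. p (x + t *\<^sub>R axis i 1)) 0"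

lemma has_derivative_along_line:
  assumes "(p has_derivative (\<lambda>h. \<Sum>i\<in>UNIV. h $ i * G i)) (at (a :: real ^ 'n))"
    and "(c has_vector_derivative v) (at t)" and "c t = a"
  shows "((\<lambda>s. p (c s)) has_real_derivative (\<Sum>i\<in>UNIV. v $ i * G i)) (at t)"
proof -
  have "(p \<circ> c has_derivative (\<lambda>h. \<Sum>i\<in>UNIV. h $ i * G i) \<circ> (\<lambda>h. h *\<^sub>R v)) (at t)"
    using assms by (intro diff_chain_at) (auto simp: has_vector_derivative_def)
  then show ?thesis
    by (simp add: has_field_derivative_def o_def mult.assoc mult_commute_abs
      flip: sum_distrib_left)
qed

lemma partial_eqI:
  assumes "(p has_derivative (\<lambda>h. \<Sum>i\<in>UNIV. h $ i * G i)) (at (x :: real ^ 'n))"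
  shows "partial k p x = G k"
proof -
  have "((\<lambda>t. x + t *\<^sub>R axis k 1) has_vector_derivative axis k 1) (at 0)"
    by (auto intro!: derivative_eq_intros)
  from has_derivative_along_line[OF assms this]
  have "((\<lambda>s. p (x + s *\<^sub>R axis k 1)) has_real_derivative (\<Sum>i\<in>UNIV. axis k 1 $ i * G i)) (at 0)"
    by simp
  moreover have "(\<Sum>i\<in>UNIV. axis k 1 $ i * G i) = G k"
    by (simp add: axis_def if_distrib[of "\<lambda>a. a * _"] cong: if_cong)
  ultimately show ?thesis
    unfolding partial_def using DERIV_imp_deriv by metis
qed

lemma sum_product_rule:
  "p * (\<Sum>i\<in>A. h i * b i) + (\<Sum>i\<in>A. h i * a i) * q = (\<Sum>i\<in>A. h i * (a i * q + p * b i))"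
  for p q :: real
  by (simp only: sum_distrib_left sum_distrib_right sum.distrib[symmetric]) (simp add: algebra_simps)

text \<open>
  The gradient is found together with the fact that its components are polynomials again, so that
  derivatives can be iterated without any further regularity argument.
\<close>

lemma polynomial_gradient_exists:
  assumes "real_polynomial_function (p :: (real ^ 'n) \<Rightarrow> real)"
  shows "\<exists>G. (\<forall>i. real_polynomial_function (G i)) \<and>
    (\<forall>x. (p has_derivative (\<lambda>h. \<Sum>i\<in>UNIV. h $ i * G i x)) (at x))"
  using assms
proof induction
  case (linear f)
  have "linear f" using linear by (simp add: bounded_linear.linear)
  have "f h = (\<Sum>i\<in>UNIV. h $ i * f (axis i 1))" for h :: "real ^ 'n"
  proof -
    have "f h = f (\<Sum>i\<in>UNIV. h $ i *\<^sub>R axis i 1)"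
      using basis_expansion[of h] by (simp only: scalar_mult_eq_scaleR)
    also have "\<dots> = (\<Sum>i\<in>UNIV. h $ i * f (axis i 1))"
      by (simp add: linear_sum[OF \<open>linear f\<close>] linear_cmul[OF \<open>linear f\<close>])
    finally show ?thesis .
  qed
  then have "f = (\<lambda>h. \<Sum>i\<in>UNIV. h $ i * f (axis i 1))"
    by (rule ext)
  then have "(f has_derivative (\<lambda>h. \<Sum>i\<in>UNIV. h $ i * f (axis i 1))) (at x)" for x
    using bounded_linear_imp_has_derivative[OF linear, of "at x"] by metis
  then show ?case
    by (intro exI[of _ "\<lambda>i x. f (axis i 1)"]) auto
next
  case (const c)
  show ?case by (intro exI[of _ "\<lambda>i x. 0"]) auto
next
  case (add f g)
  then obtain F G where "\<forall>i. real_polynomial_function (F i)" "\<forall>i. real_polynomial_function (G i)"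
    "\<forall>x. (f has_derivative (\<lambda>h. \<Sum>i\<in>UNIV. h $ i * F i x)) (at x)"
    "\<forall>x. (g has_derivative (\<lambda>h. \<Sum>i\<in>UNIV. h $ i * G i x)) (at x)" by blast
  moreover from this have "((\<lambda>x. f x + g x) has_derivative
      (\<lambda>h. (\<Sum>i\<in>UNIV. h $ i * F i x) + (\<Sum>i\<in>UNIV. h $ i * G i x))) (at x)" for x
    by (intro has_derivative_add) auto
  ultimately show ?case
    by (intro exI[of _ "\<lambda>i x. F i x + G i x"]) (simp_all add: sum.distrib ring_distribs real_polynomial_function.intros)
next
  case (mult f g)
  then obtain F G where "\<forall>i. real_polynomial_function (F i)" "\<forall>i. real_polynomial_function (G i)"
    "\<forall>x. (f has_derivative (\<lambda>h. \<Sum>i\<in>UNIV. h $ i * F i x)) (at x)"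
    "\<forall>x. (g has_derivative (\<lambda>h. \<Sum>i\<in>UNIV. h $ i * G i x)) (at x)" by blast
  moreover from this have "((\<lambda>x. f x * g x) has_derivative
      (\<lambda>h. f x * (\<Sum>i\<in>UNIV. h $ i * G i x) + (\<Sum>i\<in>UNIV. h $ i * F i x) * g x)) (at x)" for x
    by (intro has_derivative_mult) auto
  ultimately show ?case
    using mult.hyps by (intro exI[of _ "\<lambda>i x. F i x * g x + f x * G i x"] conjI allI)
      (simp_all add: sum_product_rule real_polynomial_function.intros)
qed

lemma
  assumes "real_polynomial_function (p :: (real ^ 'n) \<Rightarrow> real)"
  shows real_polynomial_function_partial: "real_polynomial_function (partial i p)"
    and has_derivative_partial:
      "(p has_derivative (\<lambda>h. \<Sum>i\<in>UNIV. h $ i * partial i p x)) (at x)"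
proof -
  obtain G where G: "\<forall>i. real_polynomial_function (G i)"
    "\<forall>x. (p has_derivative (\<lambda>h. \<Sum>i\<in>UNIV. h $ i * G i x)) (at x)"
    using polynomial_gradient_exists[OF assms] by blast
  have "partial i p = G i" for i
    using partial_eqI[OF G(2)[rule_format]] by (rule ext)
  with G show "real_polynomial_function (partial i p)"
    "(p has_derivative (\<lambda>h. \<Sum>i\<in>UNIV. h $ i * partial i p x)) (at x)" by simp_all
qed

lemma partial_mult:
  assumes "real_polynomial_function p" "real_polynomial_function q"
  shows "partial i (\<lambda>x. p x * q x) x = partial i p x * q x + p x * partial i q x"
proof (rule partial_eqI)
  have "((\<lambda>x. p x * q x) has_derivative (\<lambda>h. p x * (\<Sum>i\<in>UNIV. h $ i * partial i q x) +
      (\<Sum>i\<in>UNIV. h $ i * partial i p x) * q x)) (at x)"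
    by (intro has_derivative_mult has_derivative_partial assms)
  then show "((\<lambda>x. p x * q x) has_derivative (\<lambda>h. \<Sum>i\<in>UNIV. h $ i *
      (partial i p x * q x + p x * partial i q x))) (at x)"
    by (simp only: sum_product_rule)
qed

lemma partial_diff:
  assumes "real_polynomial_function p" "real_polynomial_function q"
  shows "partial i (\<lambda>x. p x - q x) x = partial i p x - partial i q x"
proof (rule partial_eqI)
  have "((\<lambda>x. p x - q x) has_derivative (\<lambda>h. (\<Sum>i\<in>UNIV. h $ i * partial i p x) -
      (\<Sum>i\<in>UNIV. h $ i * partial i q x))) (at x)"
    by (intro has_derivative_diff has_derivative_partial assms)
  then show "((\<lambda>x. p x - q x) has_derivative
      (\<lambda>h. \<Sum>i\<in>UNIV. h $ i * (partial i p x - partial i q x))) (at x)"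
    by (simp add: sum_subtractf ring_distribs)
qed

lemma real_polynomial_function_nth [intro]: "real_polynomial_function (\<lambda>x :: real ^ 'n. x $ i)"
  by (intro real_polynomial_function.intros(1) bounded_linear_vec_nth)

lemma partial_nth: "partial i (\<lambda>x. x $ j) (x :: real ^ 'n) = (if i = j then 1 else 0)"
proof (rule partial_eqI)
  have "(\<lambda>h. \<Sum>i\<in>UNIV. (h :: real ^ 'n) $ i * (if i = j then 1 else 0)) = (\<lambda>h. h $ j)"
    by (simp add: if_distrib[of "\<lambda>a. _ * a"] cong: if_cong)
  then show "((\<lambda>x. x $ j) has_derivative (\<lambda>h. \<Sum>i\<in>UNIV. h $ i * (if i = j then 1 else 0))) (at x)"
    by (simp add: bounded_linear_imp_has_derivative bounded_linear_vec_nth)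
qed

lemma laplacian_eq_sum_partial:
  assumes "real_polynomial_function p"
  shows "laplacian p x = (\<Sum>i\<in>UNIV. partial i (partial i p) x)"
proof -
  have "deriv (\<lambda>t. p (x + t *\<^sub>R axis i 1)) = (\<lambda>s. partial i p (x + s *\<^sub>R axis i 1))" for i
  proof
    fix s
    have "((\<lambda>t. x + t *\<^sub>R axis i 1) has_vector_derivative axis i 1) (at s)"
      by (auto intro!: derivative_eq_intros)
    from has_derivative_along_line[OF has_derivative_partial[OF assms] this refl]
    have "((\<lambda>t. p (x + t *\<^sub>R axis i 1)) has_real_derivative
       (\<Sum>k\<in>UNIV. axis i 1 $ k * partial k p (x + s *\<^sub>R axis i 1))) (at s)" .
    then show "deriv (\<lambda>t. p (x + t *\<^sub>R axis i 1)) s = partial i p (x + s *\<^sub>R axis i 1)"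
      by (simp add: axis_def if_distrib[of "\<lambda>a. a * _"] DERIV_imp_deriv cong: if_cong)
  qed
  then show ?thesis
    unfolding partial_def[of _ "partial _ p"] by (simp add: laplacian_def numeral_2_eq_2)
qed

text \<open>
  Both expressions are the derivative of $c \mapsto p(cx)$ at $c = 1$.
\<close>

lemma euler_homogeneous:
  assumes p: "real_polynomial_function p"
    and hom: "\<And>c x. c > 0 \<Longrightarrow> p (c *\<^sub>R x) = c ^ k * p x"
  shows "(\<Sum>i\<in>UNIV. x $ i * partial i p x) = real k * p x"
proof -
  have "((\<lambda>c. c *\<^sub>R x) has_vector_derivative x) (at 1)"
    by (auto intro!: derivative_eq_intros)
  from has_derivative_along_line[OF has_derivative_partial[OF p] this]
  have "((\<lambda>c. p (c *\<^sub>R x)) has_real_derivative (\<Sum>i\<in>UNIV. x $ i * partial i p x)) (at 1)"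
    by simp
  moreover have "((\<lambda>c. p (c *\<^sub>R x)) has_real_derivative real k * p x) (at 1)"
  proof (rule has_field_derivative_transform_within_open[where S = "{0<..}"])
    show "((\<lambda>c. c ^ k * p x) has_real_derivative real k * p x) (at 1)"
      by (auto intro!: derivative_eq_intros)
  qed (auto simp: hom)
  ultimately show ?thesis
    using DERIV_unique by blast
qed

text \<open>
  Differentiate $p(cx + c t e_i) = c^{k+1}\,p(x + t e_i)$ with respect to $t$.
\<close>

lemma partial_homogeneous:
  assumes p: "real_polynomial_function p"
    and hom: "\<And>c x. c > 0 \<Longrightarrow> p (c *\<^sub>R x) = c ^ Suc k * p x" and "c > 0"
  shows "partial i p (c *\<^sub>R x) = c ^ k * partial i p x"
proof -
  have "((\<lambda>t. c *\<^sub>R x + t *\<^sub>R (c *\<^sub>R axis i 1)) has_vector_derivative (c *\<^sub>R axis i 1)) (at 0)"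
    by (auto intro!: derivative_eq_intros)
  from has_derivative_along_line[OF has_derivative_partial[OF p] this]
  have "((\<lambda>t. p (c *\<^sub>R x + t *\<^sub>R (c *\<^sub>R axis i 1))) has_real_derivative
     (\<Sum>k\<in>UNIV. (c *\<^sub>R axis i 1) $ k * partial k p (c *\<^sub>R x))) (at 0)" by simp
  moreover have "(\<Sum>k\<in>UNIV. (c *\<^sub>R axis i 1) $ k * partial k p (c *\<^sub>R x)) = c * partial i p (c *\<^sub>R x)"
    by (simp add: axis_def if_distrib[of "\<lambda>a. a * _"] if_distrib[of "\<lambda>a. _ * a"] cong: if_cong)
  moreover have "(\<lambda>t. p (c *\<^sub>R x + t *\<^sub>R (c *\<^sub>R axis i 1))) = (\<lambda>t. c ^ Suc k * p (x + t *\<^sub>R axis i 1))"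
    using hom[OF \<open>c > 0\<close>] by (metis mult.commute scaleR_add_right scaleR_scaleR)
  ultimately have 1: "((\<lambda>t. c ^ Suc k * p (x + t *\<^sub>R axis i 1)) has_real_derivative
     c * partial i p (c *\<^sub>R x)) (at 0)"
    by simp
  have "((\<lambda>t. x + t *\<^sub>R axis i 1) has_vector_derivative axis i 1) (at 0)"
    by (auto intro!: derivative_eq_intros)
  from has_derivative_along_line[OF has_derivative_partial[OF p] this]
  have "((\<lambda>t. p (x + t *\<^sub>R axis i 1)) has_real_derivative partial i p x) (at 0)"
    by (simp add: axis_def if_distrib[of "\<lambda>a. a * _"] cong: if_cong)
  then have "((\<lambda>t. c ^ Suc k * p (x + t *\<^sub>R axis i 1)) has_real_derivative
     c ^ Suc k * partial i p x) (at 0)"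
    by (auto intro!: derivative_eq_intros)
  from DERIV_unique[OF 1 this] \<open>c > 0\<close> show ?thesis by simp
qed

section \<open>Plane rotations\<close>

definition plane_rotation :: "'n \<Rightarrow> 'n \<Rightarrow> real \<Rightarrow> real ^ 'n \<Rightarrow> real ^ 'n" where
  "plane_rotation i j t x =
     x + (cos t - 1) *\<^sub>R (x $ i *\<^sub>R axis i 1 + x $ j *\<^sub>R axis j 1)
       + sin t *\<^sub>R (x $ i *\<^sub>R axis j 1 - x $ j *\<^sub>R axis i 1)"

lemma plane_rotation_nth:
  assumes "i \<noteq> j"
  shows "plane_rotation i j t x $ k =
    (if k = i then cos t * x $ i - sin t * x $ j
     else if k = j then sin t * x $ i + cos t * x $ j else x $ k)"
  using assms by (auto simp: plane_rotation_def axis_def algebra_simps)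

lemma plane_rotation_0 [simp]: "plane_rotation i j 0 x = x"
  by (simp add: plane_rotation_def)

lemma plane_rotation_add:
  "i \<noteq> j \<Longrightarrow> plane_rotation i j s (plane_rotation i j t x) = plane_rotation i j (s + t) x"
  by (simp add: vec_eq_iff plane_rotation_nth cos_add sin_add algebra_simps)

lemma linear_plane_rotation: "linear (plane_rotation i j t)"
  by (intro linearI) (simp_all add: plane_rotation_def algebra_simps)

lemma norm_plane_rotation:
  assumes "i \<noteq> j"
  shows "norm (plane_rotation i j t x) = norm x"
proof -
  have 0: "axis i 1 \<bullet> axis j (1::real) = 0" "axis j 1 \<bullet> axis i (1::real) = 0"
    "axis i 1 $ j = (0::real)" "axis j 1 $ i = (0::real)"
    using assms by (simp_all add: inner_axis) (simp_all add: axis_def)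
  define u where "u = x $ i *\<^sub>R axis i 1 + x $ j *\<^sub>R axis j (1::real)"
  define v where "v = x $ i *\<^sub>R axis j 1 - x $ j *\<^sub>R axis i (1::real)"
  define S where "S = x $ i * x $ i + x $ j * x $ j"
  have ips: "x \<bullet> u = S" "x \<bullet> v = 0" "u \<bullet> u = S" "v \<bullet> v = S" "u \<bullet> v = 0"
    by (simp_all add: u_def v_def S_def inner_add_left inner_add_right inner_diff_left
      inner_diff_right inner_axis inner_axis' 0)
  have "(x + a *\<^sub>R u + b *\<^sub>R v) \<bullet> (x + a *\<^sub>R u + b *\<^sub>R v) = x \<bullet> x + (2 * a + a * a + b * b) * S" for a b
    using ips by (simp add: inner_add_left inner_add_right inner_commute[of u x]
      inner_commute[of v x] inner_commute[of v u] algebra_simps)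
  then have "plane_rotation i j t x \<bullet> plane_rotation i j t x =
      x \<bullet> x + (2 * (cos t - 1) + (cos t - 1) * (cos t - 1) + sin t * sin t) * S"
    by (simp add: plane_rotation_def u_def v_def)
  also have "2 * (cos t - 1) + (cos t - 1) * (cos t - 1) + sin t * sin t = 0"
    using sin_cos_squared_add3[of t] by (simp add: algebra_simps)
  finally have "plane_rotation i j t x \<bullet> plane_rotation i j t x = x \<bullet> x"
    by simp
  then show ?thesis by (simp add: norm_eq_sqrt_inner)
qed

text \<open>
  The determinant is $1$ and not $-1$ because a plane rotation is the square of the rotation by half
  the angle.
\<close>

lemma plane_rotation_matrix:
  fixes i j :: "'n :: finite"
  assumes "i \<noteq> j"
  obtains Q where "rotation_matrix Q" "(*v) Q = plane_rotation i j t"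
proof
  have orth: "orthogonal_matrix (matrix (plane_rotation i j t))" for t
    using linear_plane_rotation[of i j t] norm_plane_rotation[OF assms, of t]
    using orthogonal_transformation[of "plane_rotation i j t"]
      orthogonal_transformation_matrix[of "plane_rotation i j t"] by simp
  have "plane_rotation i j t = plane_rotation i j (t/2) \<circ> plane_rotation i j (t/2)"
    using assms by (auto simp: plane_rotation_add)
  then have "matrix (plane_rotation i j t) =
      matrix (plane_rotation i j (t/2)) ** matrix (plane_rotation i j (t/2))"
    by (simp add: matrix_compose linear_plane_rotation)
  then have "det (matrix (plane_rotation i j t)) = (det (matrix (plane_rotation i j (t/2))))\<^sup>2"
    by (simp add: det_mul power2_eq_square)
  also have "\<dots> = 1"
    using det_orthogonal_matrix[OF orth[of "t/2"]] by auto
  finally show "rotation_matrix (matrix (plane_rotation i j t))"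
    using orth by (simp add: rotation_matrix_def)
  show "(*v) (matrix (plane_rotation i j t)) = plane_rotation i j t"
    by (auto simp: linear_plane_rotation matrix_works)
qed

text \<open>
  The orbits of the plane rotations are the integral curves of the vector field $x_i e_j - x_j e_i$,
  so the derivative along an orbit is that of the field at the current point, for every $t$ and not
  only at $t = 0$.
\<close>

lemma has_real_derivative_along_rotation:
  assumes p: "real_polynomial_function p" and "i \<noteq> j"
  shows "((\<lambda>t. p (plane_rotation i j t x)) has_real_derivative
    (let y = plane_rotation i j t x in y $ i * partial j p y - y $ j * partial i p y)) (at t)"
proof -
  define y where "y = plane_rotation i j t x"
  define v where "v = (- sin t) *\<^sub>R (x $ i *\<^sub>R axis i 1 + x $ j *\<^sub>R axis j 1)
       + cos t *\<^sub>R (x $ i *\<^sub>R axis j 1 - x $ j *\<^sub>R axis i (1::real))"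
  have "((\<lambda>t. plane_rotation i j t x) has_vector_derivative v) (at t)"
    unfolding plane_rotation_def v_def by (auto intro!: derivative_eq_intros)
  from has_derivative_along_line[OF has_derivative_partial[OF p] this refl]
  have "((\<lambda>t. p (plane_rotation i j t x)) has_real_derivative
     (\<Sum>k\<in>UNIV. v $ k * partial k p y)) (at t)" by (simp add: y_def)
  moreover have "v = y $ i *\<^sub>R axis j 1 - y $ j *\<^sub>R axis i 1"
    using \<open>i \<noteq> j\<close> unfolding y_def v_def
    by (auto simp: vec_eq_iff plane_rotation_nth axis_def algebra_simps)
  then have "(\<Sum>k\<in>UNIV. v $ k * partial k p y) = y $ i * partial j p y - y $ j * partial i p y"
    by (simp add: axis_def ring_distribs sum_subtractf if_distrib[of "\<lambda>a. a * _"] 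
       if_distrib[of "\<lambda>a. _ * a"] cong: if_cong)
  ultimately show ?thesis by (simp add: y_def Let_def)
qed

section \<open>Orthogonality of harmonics of different degrees\<close>

locale rotation_invariant =
  fixes \<omega> :: "(real ^ 'n) measure"
  assumes rotation_invariant: "rotation_invariant_prob \<omega>"
begin

lemma sets_eq: "sets \<omega> = sets (restrict_space borel usphere)"
  using rotation_invariant by (simp add: rotation_invariant_prob_def)

lemma space_eq [simp]: "space \<omega> = usphere"
  using sets_eq_imp_space_eq[OF sets_eq] by (simp add: space_restrict_space)

sublocale finite_measure \<omega>
  using rotation_invariant by (intro finite_measureI) (simp add: rotation_invariant_prob_def)

lemma measurable_continuous [intro]:
  fixes f :: "real ^ 'n \<Rightarrow> 'b :: topological_space"
  shows "continuous_on usphere f \<Longrightarrow> f \<in> borel_measurable \<omega>"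
  using borel_measurable_continuous_on_restrict[of usphere f] measurable_cong_sets[OF sets_eq refl]
  by blast

lemma integrable_bounded:
  assumes "f \<in> borel_measurable \<omega>" "\<And>x. x \<in> usphere \<Longrightarrow> \<bar>f x\<bar> \<le> (B :: real)"
  shows "integrable \<omega> f"
  using assms by (intro integrable_const_bound[of _ B]) auto

lemma polynomial_bounded:
  assumes "real_polynomial_function (p :: real ^ 'n \<Rightarrow> real)"
  obtains B where "\<And>x. x \<in> usphere \<Longrightarrow> \<bar>p x\<bar> \<le> B"
proof -
  have "compact (p ` usphere)"
    using assms by (intro compact_continuous_image continuous_on_polymonial_function)
      (auto simp: real_polynomial_function_eq)
  from compact_imp_bounded[OF this] show ?thesis
    using that unfolding bounded_iff by (metis imageI real_norm_def)
qed

lemma integrable_polynomial: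
  assumes "real_polynomial_function (p :: real ^ 'n \<Rightarrow> real)"
  shows "integrable \<omega> p"
proof -
  obtain B where "\<And>x. x \<in> usphere \<Longrightarrow> \<bar>p x\<bar> \<le> B"
    using polynomial_bounded[OF assms] by metis
  moreover have "continuous_on usphere p"
    using assms by (intro continuous_on_polymonial_function) (auto simp: real_polynomial_function_eq)
  ultimately show ?thesis
    by (intro integrable_bounded) auto
qed

text \<open>
  The integral of $p$ over the rotated sphere does not depend on the angle; differentiate it at the
  angle $0$. The difference quotients are, by the mean value theorem, values of the derivative along
  the orbit, hence bounded uniformly on the sphere, and dominated convergence applies.
\<close>

lemma integral_rotation_generator:
  assumes p: "real_polynomial_function p"
  shows "(LINT x|\<omega>. x $ i * partial j p x - x $ j * partial i p x) = 0"
proof (cases "i = j")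
  case False
  define D where "D x = x $ i * partial j p x - x $ j * partial i p x" for x
  have D: "real_polynomial_function D"
    unfolding D_def using p
    by (intro real_polynomial_function_diff real_polynomial_function.intros(4)
      real_polynomial_function_nth real_polynomial_function_partial)
  obtain B where B: "\<And>x. x \<in> usphere \<Longrightarrow> \<bar>D x\<bar> \<le> B"
    using polynomial_bounded[OF D] by blast
  have der: "((\<lambda>t. p (plane_rotation i j t x)) has_real_derivative D (plane_rotation i j t x)) (at t)"
    for x t using has_real_derivative_along_rotation[OF p False] by (simp add: D_def Let_def)
  have rot: "plane_rotation i j t x \<in> usphere" if "x \<in> usphere" for x t
    using that False by (simp add: norm_plane_rotation)
  have contp: "continuous_on A p" for A
    using p by (intro continuous_on_polymonial_function) (auto simp: real_polynomial_function_eq)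
  have contr: "continuous_on A (plane_rotation i j t)" for A t
    by (simp add: linear_continuous_on linear_conv_bounded_linear[THEN iffD1] linear_plane_rotation)
  have meas: "(\<lambda>x. p (plane_rotation i j t x)) \<in> borel_measurable \<omega>" for t
    by (intro measurable_continuous continuous_on_compose2[OF contp contr subset_UNIV])
  have inv: "(LINT x|\<omega>. p (plane_rotation i j t x)) = (LINT x|\<omega>. p x)" for t
  proof -
    obtain Q where Q: "rotation_matrix Q" "(*v) Q = plane_rotation i j t"
      using plane_rotation_matrix[OF False] .
    then have d: "distr \<omega> \<omega> (plane_rotation i j t) = \<omega>"
      using rotation_invariant unfolding rotation_invariant_prob_def by metis
    have "plane_rotation i j t \<in> measurable \<omega> (restrict_space borel usphere)"
      using rot by (intro measurable_restrict_space2 measurable_continuous contr) auto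
    then have "plane_rotation i j t \<in> measurable \<omega> \<omega>"
      using measurable_cong_sets[OF refl sets_eq] by blast
    then have "(LINT x|distr \<omega> \<omega> (plane_rotation i j t). p x) = (LINT x|\<omega>. p (plane_rotation i j t x))"
      by (intro integral_distr measurable_continuous contp)
    with d show ?thesis by simp
  qed
  have int: "integrable \<omega> (\<lambda>x. p (plane_rotation i j t x))" for t
  proof -
    obtain C where "\<And>x. x \<in> usphere \<Longrightarrow> \<bar>p x\<bar> \<le> C"
      using polynomial_bounded[OF p] by blast
    with rot meas show ?thesis by (intro integrable_bounded[of _ C]) auto
  qed
  define q where "q n x = (p (plane_rotation i j (inverse (real (Suc n))) x) - p x) / inverse (real (Suc n))"
    for n x
  have "(\<lambda>n. LINT x|\<omega>. q n x) \<longlonglongrightarrow> (LINT x|\<omega>. D x)"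
  proof (rule integral_dominated_convergence[where w = "\<lambda>_. B"])
    show "D \<in> borel_measurable \<omega>" using integrable_polynomial[OF D] by auto
    show "q n \<in> borel_measurable \<omega>" for n
      unfolding q_def using meas[of "inverse (real (Suc n))"] meas[of 0] by simp
    show "AE x in \<omega>. (\<lambda>n. q n x) \<longlonglongrightarrow> D x"
    proof (rule AE_I2)
      fix x
      have "((\<lambda>h. (p (plane_rotation i j h x) - p x) / h) \<longlongrightarrow> D x) (at 0)"
        using der[of x 0] by (simp add: DERIV_def)
      moreover have "filterlim (\<lambda>n. inverse (real (Suc n))) (at 0) sequentially"
        using LIMSEQ_inverse_real_of_nat by (simp add: filterlim_at)
      ultimately show "(\<lambda>n. q n x) \<longlonglongrightarrow> D x"
        unfolding q_def by (rule filterlim_compose)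
    qed
    show "AE x in \<omega>. norm (q n x) \<le> B" for n
    proof (rule AE_I2)
      fix x assume x: "x \<in> space \<omega>"
      define h where "h = inverse (real (Suc n))"
      have "h > 0" by (simp add: h_def)
      then obtain z where "p (plane_rotation i j h x) - p (plane_rotation i j 0 x)
           = (h - 0) * D (plane_rotation i j z x)"
        using MVT2[of 0 h "\<lambda>t. p (plane_rotation i j t x)" "\<lambda>t. D (plane_rotation i j t x)"] der by blast
      then have "q n x = D (plane_rotation i j z x)"
        using \<open>h > 0\<close> unfolding q_def h_def[symmetric] by simp
      then show "norm (q n x) \<le> B" using B rot x by simp
    qed
  qed auto
  moreover have "(\<lambda>n. LINT x|\<omega>. q n x) = (\<lambda>n. 0)"
  proof
    show "(LINT x|\<omega>. q n x) = 0" for n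
      unfolding q_def using int[of "inverse (real (Suc n))"] int[of 0] inv
      by simp
  qed
  ultimately have "(LINT x|\<omega>. D x) = 0"
    by (metis LIMSEQ_const_iff)
  then show ?thesis by (simp add: D_def)
qed simp

text \<open>
  A divergence theorem on the sphere: on $|x| = 1$ the integrand is
  $\mathrm{div}\,F - (n - 1)\,x \cdot F - \sum_{i,j} x_i x_j\,\partial_i F_j$, which for a tangential
  field is its divergence along the sphere.
\<close>

lemma integral_tangential_divergence:
  assumes F: "\<And>j. real_polynomial_function (F j)"
  shows "(LINT x|\<omega>. (\<Sum>i\<in>UNIV. \<Sum>j\<in>UNIV.
     x $ i * partial j (\<lambda>x. x $ i * F j x) x - x $ j * partial i (\<lambda>x. x $ i * F j x) x)) = 0"
proof -
  have g: "real_polynomial_function (\<lambda>x. x $ i * F j x)" for i j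
    using F by (intro real_polynomial_function.intros(4) real_polynomial_function_nth)
  define D where "D i j x =
    x $ i * partial j (\<lambda>x. x $ i * F j x) x - x $ j * partial i (\<lambda>x. x $ i * F j x) x" for i j x
  have "integrable \<omega> (D i j)" for i j
    unfolding D_def by (intro integrable_polynomial real_polynomial_function_diff
      real_polynomial_function.intros(4) real_polynomial_function_nth real_polynomial_function_partial g)
  then have "(LINT x|\<omega>. (\<Sum>i\<in>UNIV. \<Sum>j\<in>UNIV. D i j x)) = (\<Sum>i\<in>UNIV. \<Sum>j\<in>UNIV. LINT x|\<omega>. D i j x)"
    by (subst Bochner_Integration.integral_sum; simp add: Bochner_Integration.integral_sum)
  moreover have "(LINT x|\<omega>. D i j x) = 0" for i j
    unfolding D_def by (rule integral_rotation_generator[OF g])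
  ultimately show ?thesis by (simp add: D_def)
qed

text \<open>
  Apply the divergence theorem to $F = q\,\nabla p - p\,\nabla q$. The divergence of $F$ vanishes
  since $p$ and $q$ are harmonic, Euler's relation gives $x \cdot F = (k - l)\,pq$, and $F$ is
  homogeneous of degree $k + l - 1$, so that on the sphere the integrand is
  $-(n + k + l - 2)(k - l)\,pq$. For $n \ge 2$ and $k \ne l$ the constant is not zero.
\<close>

lemma homogeneous_harmonics_orthogonal:
  fixes p q :: "real ^ 'n \<Rightarrow> real"
  assumes p: "real_polynomial_function p" and q: "real_polynomial_function q"
    and hp: "\<And>c x. p (c *\<^sub>R x) = c ^ k * p x" and hq: "\<And>c x. q (c *\<^sub>R x) = c ^ l * q x"
    and lp: "\<And>x. laplacian p x = 0" and lq: "\<And>x. laplacian q x = 0"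
    and "k \<noteq> l" and dim: "CARD('n) \<ge> 2"
  shows "(LINT x|\<omega>. p x * q x) = 0"
proof -
  define F where "F j x = q x * partial j p x - p x * partial j q x" for j x
  note poly = p q real_polynomial_function_diff real_polynomial_function.intros(4)
      real_polynomial_function_nth real_polynomial_function_partial
  have F: "real_polynomial_function (F j)" for j
    unfolding F_def by (intro poly)
  have divF: "(\<Sum>j\<in>UNIV. partial j (F j) x) = 0" for x
  proof -
    have "partial j (F j) x = q x * partial j (partial j p) x - p x * partial j (partial j q) x" for j
    proof -
      have "partial j (F j) x =
          partial j (\<lambda>x. q x * partial j p x) x - partial j (\<lambda>x. p x * partial j q x) x"
        unfolding F_def by (intro partial_diff poly)
      also have "partial j (\<lambda>x. q x * partial j p x) x =
          partial j q x * partial j p x + q x * partial j (partial j p) x"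
        by (intro partial_mult poly)
      also have "partial j (\<lambda>x. p x * partial j q x) x =
          partial j p x * partial j q x + p x * partial j (partial j q) x"
        by (intro partial_mult poly)
      finally show ?thesis by (simp add: mult.commute)
    qed
    then have "(\<Sum>j\<in>UNIV. partial j (F j) x) = q x * laplacian p x - p x * laplacian q x"
      by (simp add: sum_subtractf sum_distrib_left laplacian_eq_sum_partial p q)
    then show ?thesis by (simp add: lp lq)
  qed
  have rF: "(\<Sum>j\<in>UNIV. x $ j * F j x) = (real k - real l) * (p x * q x)" for x
  proof -
    have "(\<Sum>j\<in>UNIV. x $ j * F j x) =
        q x * (\<Sum>j\<in>UNIV. x $ j * partial j p x) - p x * (\<Sum>j\<in>UNIV. x $ j * partial j q x)"
      by (simp add: F_def algebra_simps sum_subtractf sum_distrib_left)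
    also have "\<dots> = q x * (real k * p x) - p x * (real l * q x)"
      by (simp add: euler_homogeneous[OF p hp] euler_homogeneous[OF q hq])
    finally show ?thesis by (simp add: algebra_simps)
  qed
  have EF: "(\<Sum>i\<in>UNIV. x $ i * partial i (F j) x) = (real k + real l - 1) * F j x" for j x
  proof -
    have "F j (c *\<^sub>R x) = c ^ (k + l - 1) * F j x" if "c > 0" for c x
    proof -
      \<comment> \<open>For \<open>k = 0\<close> there is no power \<open>k - 1\<close> to split off, but then \<open>p\<close> is constant.\<close>
      have 1: "q (c *\<^sub>R x) * partial j p (c *\<^sub>R x) = c ^ (k + l - 1) * (q x * partial j p x)" 
      if p: "real_polynomial_function p" "\<And>c x. p (c *\<^sub>R x) = c ^ k * p x" 
       and q: "\<And>c x. q (c *\<^sub>R x) = c ^ l * q x" for p q :: "real ^ 'n \<Rightarrow> real" and k l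
      proof (cases k)
        case 0
        have "partial j p x = 0" for x
        proof -
          have "p x = p 0" for x using p(2)[of 0 x] 0 by simp
          then have "p = (\<lambda>x. p 0)" by (rule ext)
          then have "partial j p x = partial j (\<lambda>x. p 0) x" by simp
          also have "\<dots> = 0" by (simp add: partial_def)
          finally show ?thesis .
        qed
        then show ?thesis by simp
      next
        case (Suc k')
        then have "partial j p (c *\<^sub>R x) = c ^ k' * partial j p x"
          using p \<open>c > 0\<close> by (intro partial_homogeneous) auto
        with Suc q show ?thesis by (simp add: power_add)
      qed
      show ?thesis
        using 1[OF p hp hq] 1[OF q hq hp]
        by (simp only: F_def right_diff_distrib add.commute)
    qed
    from euler_homogeneous[OF F this]
    have "(\<Sum>i\<in>UNIV. x $ i * partial i (F j) x) = real (k + l - 1) * F j x" .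
    moreover have "real (k + l - 1) = real k + real l - 1"
      using \<open>k \<noteq> l\<close> by (cases "k + l") auto
    ultimately show ?thesis by simp
  qed
  have "(\<Sum>i\<in>UNIV. \<Sum>j\<in>UNIV.
       x $ i * partial j (\<lambda>x. x $ i * F j x) x - x $ j * partial i (\<lambda>x. x $ i * F j x) x) =
     - (real CARD('n) + real k + real l - 2) * (real k - real l) * (p x * q x)" (is "?l = _")
    if x: "x \<in> usphere" for x
  proof -
    have part: "partial a (\<lambda>x. x $ i * F j x) x = (if a = i then F j x else 0) + x $ i * partial a (F j) x" for a i j
      by (simp add: partial_mult[OF real_polynomial_function_nth F] partial_nth)
    have nrm: "(\<Sum>i\<in>UNIV. x $ i * x $ i) = 1"
      using x by (simp add: norm_eq_sqrt_inner inner_vec_def)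
    have "?l = (\<Sum>i\<in>UNIV. \<Sum>j\<in>UNIV. (if j = i then x $ i * F j x else 0))
       + (\<Sum>i\<in>UNIV. \<Sum>j\<in>UNIV. (x $ i * x $ i) * partial j (F j) x)
       - (\<Sum>i\<in>(UNIV :: 'n set). \<Sum>j\<in>UNIV. x $ j * F j x)
       - (\<Sum>i\<in>UNIV. \<Sum>j\<in>UNIV. x $ j * (x $ i * partial i (F j) x))"
      by (simp add: part sum.distrib sum_subtractf ring_distribs mult.assoc
          if_distrib[of "\<lambda>a. _ * a"] cong: if_cong)
    also have "(\<Sum>i\<in>UNIV. \<Sum>j\<in>UNIV. (if j = i then x $ i * F j x else 0)) = (\<Sum>j\<in>UNIV. x $ j * F j x)"
      by simp
    also have "(\<Sum>i\<in>UNIV. \<Sum>j\<in>UNIV. (x $ i * x $ i) * partial j (F j) x) = 0"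
      by (simp add: sum_distrib_left[symmetric] divF)
    also have "(\<Sum>i\<in>UNIV. \<Sum>j\<in>UNIV. x $ j * (x $ i * partial i (F j) x)) =
        (real k + real l - 1) * (\<Sum>j\<in>UNIV. x $ j * F j x)"
      by (subst sum.swap) (simp add: sum_distrib_left[symmetric] EF, simp add: sum_distrib_left mult_ac)
    finally show ?thesis
      by (simp add: rF) (simp add: algebra_simps)
  qed
  then have "(LINT x|\<omega>. - (real CARD('n) + real k + real l - 2) * (real k - real l) * (p x * q x)) =
      (LINT x|\<omega>. (\<Sum>i\<in>UNIV. \<Sum>j\<in>UNIV.
       x $ i * partial j (\<lambda>x. x $ i * F j x) x - x $ j * partial i (\<lambda>x. x $ i * F j x) x))"
    by (intro Bochner_Integration.integral_cong) simp_all
  also have "\<dots> = 0"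
    by (rule integral_tangential_divergence[OF F])
  finally have "(LINT x|\<omega>. - (real CARD('n) + real k + real l - 2) * (real k - real l) * (p x * q x)) = 0" .
  then have "(real CARD('n) + real k + real l - 2) * (real k - real l) * (LINT x|\<omega>. p x * q x) = 0"
    by (simp add: mult.assoc)
  moreover have "real CARD('n) + real k + real l - 2 \<noteq> 0"
    using dim \<open>k \<noteq> l\<close> by linarith
  ultimately show ?thesis using \<open>k \<noteq> l\<close> by simp
qed

end

section \<open>Hilbert spaces of functions\<close>

text \<open>
  Sums, differences and multiples are written with this one operation, in terms of which linearity
  is formulated for positive operators.
\<close>

definition lincomb :: "real \<Rightarrow> ('a \<Rightarrow> real) \<Rightarrow> real \<Rightarrow> ('a \<Rightarrow> real) \<Rightarrow> 'a \<Rightarrow> real" where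
  "lincomb a f b g = (\<lambda>x. a * f x + b * g x)"

lemma quadratic_nonneg_discriminant:
  fixes a b c :: real
  assumes "\<And>t. 0 \<le> a + 2 * t * b + t * t * c" and "0 \<le> c"
  shows "b\<^sup>2 \<le> a * c"
proof (cases "c = 0")
  case True
  have "b = 0"
  proof (rule ccontr)
    assume "b \<noteq> 0"
    then show False using assms(1)[of "- (a + 1) / (2 * b)"] True \<open>b \<noteq> 0\<close> by (simp add: field_simps)
  qed
  with True show ?thesis by simp
next
  case False
  with \<open>0 \<le> c\<close> have "c > 0" by simp
  then show ?thesis
    using assms(1)[of "- b / c"] by (simp add: field_simps power2_eq_square)
qed

locale function_hilbert_space =
  fixes H :: "('a \<Rightarrow> real) set"
    and ip :: "('a \<Rightarrow> real) \<Rightarrow> ('a \<Rightarrow> real) \<Rightarrow> real"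
  assumes zero_mem: "(\<lambda>_. 0) \<in> H"
    and lincomb_mem [simp]: "f \<in> H \<Longrightarrow> g \<in> H \<Longrightarrow> lincomb a f b g \<in> H"
    and ip_commute: "f \<in> H \<Longrightarrow> g \<in> H \<Longrightarrow> ip f g = ip g f"
    and ip_lincomb_left [simp]:
      "f \<in> H \<Longrightarrow> g \<in> H \<Longrightarrow> h \<in> H \<Longrightarrow> ip (lincomb a f b g) h = a * ip f h + b * ip g h"
    and ip_nonneg [simp]: "f \<in> H \<Longrightarrow> 0 \<le> ip f f"
    and ip_eq_0: "f \<in> H \<Longrightarrow> ip f f = 0 \<Longrightarrow> f = (\<lambda>_. 0)"
    and complete:
      "\<lbrakk>\<And>n :: nat. u n \<in> H;
        \<And>e. e > 0 \<Longrightarrow> \<exists>M. \<forall>m\<ge>M. \<forall>n\<ge>M.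
          sqrt (ip (lincomb 1 (u m) (-1) (u n)) (lincomb 1 (u m) (-1) (u n))) < e\<rbrakk>
       \<Longrightarrow> \<exists>f\<in>H. (\<lambda>n. sqrt (ip (lincomb 1 (u n) (-1) f) (lincomb 1 (u n) (-1) f))) \<longlonglongrightarrow> 0"
begin

definition nrm :: "('a \<Rightarrow> real) \<Rightarrow> real" where "nrm f = sqrt (ip f f)"

lemma ip_lincomb_right [simp]:
  "f \<in> H \<Longrightarrow> g \<in> H \<Longrightarrow> h \<in> H \<Longrightarrow> ip h (lincomb a f b g) = a * ip h f + b * ip h g"
  by (metis ip_commute ip_lincomb_left lincomb_mem)

lemma nrm_nonneg [simp]: "f \<in> H \<Longrightarrow> 0 \<le> nrm f"
  by (simp add: nrm_def)

lemma nrm_square: "f \<in> H \<Longrightarrow> nrm f * nrm f = ip f f"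
  by (simp add: nrm_def)

lemma positive_form_Cauchy_Schwarz:
  assumes B: "\<And>f g a b. f \<in> H \<Longrightarrow> g \<in> H \<Longrightarrow>
      B (lincomb a f b g) (lincomb a f b g) = a * a * B f f + 2 * a * b * B f g + b * b * B g g"
    and "\<And>f. f \<in> H \<Longrightarrow> 0 \<le> B f f" and "f \<in> H" "g \<in> H"
  shows "(B f g)\<^sup>2 \<le> B f f * (B g g :: real)"
proof (rule quadratic_nonneg_discriminant)
  fix t :: real
  have "0 \<le> B (lincomb 1 f t g) (lincomb 1 f t g)" using assms by (metis lincomb_mem)
  then show "0 \<le> B f f + 2 * t * B f g + t * t * B g g"
    using B[OF assms(3,4), of 1 t] by simp
qed (use assms in blast)

lemma Cauchy_Schwarz:
  assumes "f \<in> H" "g \<in> H"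
  shows "\<bar>ip f g\<bar> \<le> nrm f * nrm g"
proof -
  have "(ip f g)\<^sup>2 \<le> ip f f * ip g g"
    using assms by (intro positive_form_Cauchy_Schwarz) (auto simp: ip_commute algebra_simps)
  then have "sqrt ((ip f g)\<^sup>2) \<le> sqrt (ip f f * ip g g)" by (rule real_sqrt_le_mono)
  then show ?thesis by (simp add: nrm_def real_sqrt_mult)
qed

lemma nrm_lincomb_le:
  assumes "f \<in> H" "g \<in> H"
  shows "nrm (lincomb a f b g) \<le> \<bar>a\<bar> * nrm f + \<bar>b\<bar> * nrm g"
proof -
  have "ip (lincomb a f b g) (lincomb a f b g) = a * a * ip f f + 2 * (a * b * ip f g) + b * b * ip g g"
    using assms by (simp add: ip_commute algebra_simps)
  moreover have "a * b * ip f g \<le> \<bar>a * b\<bar> * (nrm f * nrm g)"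
    using mult_left_mono[OF Cauchy_Schwarz[OF assms], of "\<bar>a * b\<bar>"] abs_ge_self[of "a * b * ip f g"]
    by (simp add: abs_mult)
  ultimately have "ip (lincomb a f b g) (lincomb a f b g) \<le> (\<bar>a\<bar> * nrm f + \<bar>b\<bar> * nrm g)\<^sup>2"
  proof -
    have "(\<bar>a\<bar> * nrm f + \<bar>b\<bar> * nrm g)\<^sup>2 =
        a * a * ip f f + 2 * (\<bar>a * b\<bar> * (nrm f * nrm g)) + b * b * ip g g"
      using assms by (simp add: power2_sum power_mult_distrib nrm_def abs_mult power2_eq_square[of a]
        power2_eq_square[of b])
    with \<open>ip (lincomb a f b g) (lincomb a f b g) = _\<close> \<open>a * b * ip f g \<le> _\<close> show ?thesis by linarith
  qed
  then show ?thesis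
    unfolding nrm_def[of "lincomb a f b g"] using assms by (intro real_le_lsqrt) auto
qed

definition dst :: "('a \<Rightarrow> real) \<Rightarrow> ('a \<Rightarrow> real) \<Rightarrow> real" where "dst f g = nrm (lincomb 1 f (-1) g)"

lemma dst_triangle:
  assumes "f \<in> H" "g \<in> H" "h \<in> H"
  shows "dst f h \<le> dst f g + dst g h"
proof -
  have "lincomb 1 f (-1) h = lincomb 1 (lincomb 1 f (-1) g) 1 (lincomb 1 g (-1) h)"
    by (simp add: lincomb_def)
  then show ?thesis
    using nrm_lincomb_le[of "lincomb 1 f (-1) g" "lincomb 1 g (-1) h" 1 1] assms by (simp add: dst_def)
qed

lemma dst_commute:
  assumes "f \<in> H" "g \<in> H"
  shows "dst f g = dst g f"
  using assms by (simp add: dst_def nrm_def ip_commute algebra_simps)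

lemma dst_nonneg [simp]: "f \<in> H \<Longrightarrow> g \<in> H \<Longrightarrow> 0 \<le> dst f g"
  by (simp add: dst_def)

lemma eq_if_dst_0:
  assumes "f \<in> H" "g \<in> H" "dst f g = 0"
  shows "f = g"
proof -
  have "lincomb 1 f (-1) g = (\<lambda>_. 0)"
    using assms by (intro ip_eq_0) (simp_all add: dst_def nrm_def)
  then show ?thesis by (simp add: lincomb_def fun_eq_iff)
qed

lemma weak_eqI:
  assumes "f \<in> H" "g \<in> H" "\<And>h. h \<in> H \<Longrightarrow> ip f h = ip g h"
  shows "f = g"
proof (rule eq_if_dst_0)
  show "dst f g = 0" using assms by (simp add: dst_def nrm_def)
qed fact+

text \<open>
  This is the only form in which completeness enters: both iterations below contract with a fixed
  ratio.
\<close>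

lemma geometric_limit:
  assumes u: "\<And>n. u n \<in> H" and r: "0 \<le> r" "r < 1"
    and step: "\<And>n. dst (u (Suc n)) (u n) \<le> C * r ^ n"
  shows "\<exists>f\<in>H. \<forall>n. dst (u n) f \<le> C * r ^ n / (1 - r)"
proof -
  have "C \<ge> 0" using step[of 0] dst_nonneg[OF u u, of 1 0] by simp
  have tail: "dst (u (n + k)) (u n) \<le> C * r ^ n / (1 - r)" for n k
  proof -
    have "dst (u (n + k)) (u n) \<le> C * r ^ n * (1 - r ^ k) / (1 - r)"
    proof (induction k)
      case 0
      show ?case using u by (simp add: dst_def nrm_def)
    next
      case (Suc k)
      have "dst (u (n + Suc k)) (u n) \<le> dst (u (Suc (n + k))) (u (n + k)) + dst (u (n + k)) (u n)"
        using dst_triangle[OF u u u] by simp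
      also have "\<dots> \<le> C * r ^ (n + k) + C * r ^ n * (1 - r ^ k) / (1 - r)"
        by (intro add_mono step Suc)
      also have "\<dots> = C * r ^ n * (1 - r ^ Suc k) / (1 - r)"
        using r by (simp add: field_simps power_add)
      finally show ?case .
    qed
    also have "\<dots> \<le> C * r ^ n * 1 / (1 - r)"
      using r \<open>C \<ge> 0\<close> by (intro divide_right_mono mult_left_mono) auto
    finally show ?thesis by simp
  qed
  have lim0: "(\<lambda>n. C * r ^ n / (1 - r)) \<longlonglongrightarrow> 0"
    using r by (auto intro!: tendsto_eq_intros LIMSEQ_realpow_zero)
  have "\<exists>f\<in>H. (\<lambda>n. sqrt (ip (lincomb 1 (u n) (-1) f) (lincomb 1 (u n) (-1) f))) \<longlonglongrightarrow> 0"
  proof (rule complete[OF u])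
    fix e :: real assume "e > 0"
    then have "\<forall>\<^sub>F n in sequentially. C * r ^ n / (1 - r) < e / 2"
      using order_tendstoD(2)[OF lim0, of "e / 2"] by simp
    then obtain M where M: "C * r ^ M / (1 - r) < e / 2"
      by (auto simp: eventually_sequentially)
    have "dst (u m) (u M) < e / 2" if "m \<ge> M" for m
      using tail[of M "m - M"] that M by (simp only: le_add_diff_inverse)
    then have "dst (u m) (u n) < e" if "m \<ge> M" "n \<ge> M" for m n
      using dst_triangle[OF u[of m] u[of M] u[of n]] dst_commute[OF u[of M] u[of n]] that
      by (smt (verit) field_sum_of_halves)
    then show "\<exists>M. \<forall>m\<ge>M. \<forall>n\<ge>M.
        sqrt (ip (lincomb 1 (u m) (-1) (u n)) (lincomb 1 (u m) (-1) (u n))) < e"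
      unfolding dst_def nrm_def by blast
  qed
  then obtain f where f: "f \<in> H" "(\<lambda>n. dst (u n) f) \<longlonglongrightarrow> 0"
    unfolding dst_def nrm_def by blast
  have "dst (u n) f \<le> C * r ^ n / (1 - r)" for n
  proof (rule LIMSEQ_le_const)
    show "(\<lambda>k. C * r ^ n / (1 - r) + dst (u (k + n)) f) \<longlonglongrightarrow> C * r ^ n / (1 - r)"
      using tendsto_add[OF tendsto_const LIMSEQ_ignore_initial_segment[OF f(2), of n]] by simp
    have "dst (u n) f \<le> C * r ^ n / (1 - r) + dst (u (k + n)) f" for k
      using dst_triangle[OF u[of n] u[of "n + k"] f(1)] tail[of n k] dst_commute[OF u[of n] u[of "n + k"]]
      by (simp add: add.commute)
    then show "\<exists>N. \<forall>k\<ge>N. dst (u n) f \<le> C * r ^ n / (1 - r) + dst (u (k + n)) f" by blast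
  qed
  with f(1) show ?thesis by blast
qed

definition linear_op :: "(('a \<Rightarrow> real) \<Rightarrow> 'a \<Rightarrow> real) \<Rightarrow> bool" where
  "linear_op T \<longleftrightarrow> (\<forall>f\<in>H. T f \<in> H) \<and>
     (\<forall>f\<in>H. \<forall>g\<in>H. \<forall>a b. T (lincomb a f b g) = lincomb a (T f) b (T g))"

definition symmetric_op :: "(('a \<Rightarrow> real) \<Rightarrow> 'a \<Rightarrow> real) \<Rightarrow> bool" where
  "symmetric_op T \<longleftrightarrow> linear_op T \<and> (\<forall>f\<in>H. \<forall>g\<in>H. ip (T f) g = ip f (T g))"

lemma linear_op_mem: "linear_op T \<Longrightarrow> f \<in> H \<Longrightarrow> T f \<in> H"
  by (simp add: linear_op_def)

lemma linear_op_lincomb: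
  "linear_op T \<Longrightarrow> f \<in> H \<Longrightarrow> g \<in> H \<Longrightarrow> T (lincomb a f b g) = lincomb a (T f) b (T g)"
  by (simp add: linear_op_def)

lemma linear_op_zero:
  assumes "linear_op T"
  shows "T (\<lambda>_. 0) = (\<lambda>_. 0)"
  using linear_op_lincomb[OF assms zero_mem zero_mem, of 0 0] by (simp add: lincomb_def)

lemma symmetric_op_linear: "symmetric_op T \<Longrightarrow> linear_op T"
  by (simp add: symmetric_op_def)

lemma symmetric_op_ip: "symmetric_op T \<Longrightarrow> f \<in> H \<Longrightarrow> g \<in> H \<Longrightarrow> ip (T f) g = ip f (T g)"
  by (simp add: symmetric_op_def)

lemma nrm_zero: "nrm (\<lambda>_. 0) = 0"
proof -
  have "(\<lambda>_. 0) = lincomb 0 (\<lambda>_. 0) 0 (\<lambda>_. 0 :: real)" by (simp add: lincomb_def)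
  then have "ip (\<lambda>_. 0) (\<lambda>_. 0) = 0"
    by (metis add_0 ip_lincomb_left mult_zero_left zero_mem)
  then show ?thesis by (simp add: nrm_def)
qed

lemma nrm_eq_0: "f \<in> H \<Longrightarrow> nrm f = 0 \<Longrightarrow> f = (\<lambda>_. 0)"
  by (intro ip_eq_0) (auto simp: nrm_def)

lemma op_norm_le:
  assumes "0 \<le> C" "\<And>f. f \<in> H \<Longrightarrow> nrm (T f) \<le> C * nrm f"
  shows "op_norm H ip T \<le> ennreal C"
  unfolding op_norm_def
proof (rule SUP_least)
  fix f assume f: "f \<in> {f \<in> H. sqrt (ip f f) \<le> 1}"
  then have "nrm (T f) \<le> C * nrm f" using assms by simp
  also have "\<dots> \<le> C * 1" using f assms by (intro mult_left_mono) (auto simp: nrm_def)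
  finally show "ennreal (sqrt (ip (T f) (T f))) \<le> ennreal C"
    by (simp add: nrm_def ennreal_leI)
qed

text \<open>
  The operator norm only sees the unit ball; homogeneity extends the bound to all of \<open>H\<close>.
\<close>

lemma op_normD:
  assumes T: "linear_op T" and C: "op_norm H ip T \<le> ennreal C" "0 \<le> C" and f: "f \<in> H"
  shows "nrm (T f) \<le> C * nrm f"
proof (cases "nrm f = 0")
  case True
  then show ?thesis using nrm_eq_0[OF f] linear_op_zero[OF T] nrm_zero by simp
next
  case False
  then have "nrm f > 0" using nrm_nonneg[OF f] by linarith
  define g where "g = lincomb (1 / nrm f) f 0 f"
  have g: "g \<in> H" using f by (simp add: g_def)
  have scale: "nrm (lincomb a h 0 h) = \<bar>a\<bar> * nrm h" if "h \<in> H" for a h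
    using that by (simp add: nrm_def real_sqrt_mult mult.assoc[symmetric])
  have "nrm g = 1" using scale[OF f, of "1 / nrm f"] \<open>nrm f > 0\<close> by (simp add: g_def)
  then have "ennreal (nrm (T g)) \<le> op_norm H ip T"
    unfolding op_norm_def nrm_def using g by (intro SUP_upper) (auto simp: nrm_def)
  also note C(1)
  finally have "nrm (T g) \<le> C" using C(2) by (simp add: ennreal_le_iff)
  moreover have "T g = lincomb (1 / nrm f) (T f) 0 (T f)"
    unfolding g_def using f by (intro linear_op_lincomb T)
  then have "nrm (T g) = nrm (T f) / nrm f"
    using scale[OF linear_op_mem[OF T f], of "1 / nrm f"] \<open>nrm f > 0\<close> by simp
  ultimately show ?thesis using \<open>nrm f > 0\<close> by (simp add: field_simps)
qed

lemma
  assumes "finite I" "\<And>i. i \<in> I \<Longrightarrow> h i \<in> H"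
  shows sum_in_H: "(\<lambda>y. \<Sum>i\<in>I. c i * h i y) \<in> H"
    and ip_sum_left: "g \<in> H \<Longrightarrow> ip (\<lambda>y. \<Sum>i\<in>I. c i * h i y) g = (\<Sum>i\<in>I. c i * ip (h i) g)"
proof -
  have "(\<lambda>y. \<Sum>i\<in>I. c i * h i y) \<in> H \<and>
      (\<forall>g\<in>H. ip (\<lambda>y. \<Sum>i\<in>I. c i * h i y) g = (\<Sum>i\<in>I. c i * ip (h i) g))"
    using assms
  proof (induction I)
    case empty
    have "ip (\<lambda>_. 0) g = 0" if "g \<in> H" for g
      using ip_lincomb_left[OF zero_mem zero_mem that, of 0 0] by (simp add: lincomb_def)
    then show ?case using zero_mem by simp
  next
    case (insert i I)
    have "(\<lambda>y. \<Sum>i\<in>insert i I. c i * h i y) = lincomb (c i) (h i) 1 (\<lambda>y. \<Sum>i\<in>I. c i * h i y)"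
      using insert.hyps by (simp add: lincomb_def)
    then show ?case using insert by simp
  qed
  then show "(\<lambda>y. \<Sum>i\<in>I. c i * h i y) \<in> H"
    "g \<in> H \<Longrightarrow> ip (\<lambda>y. \<Sum>i\<in>I. c i * h i y) g = (\<Sum>i\<in>I. c i * ip (h i) g)" by auto
qed

text \<open>
  The form $(f, g) \mapsto \langle Tf, g\rangle$ is positive, so the Cauchy--Schwarz inequality for it
  at $g = Tf$ gives
  $\|Tf\|^4 \le \langle Tf, f\rangle\,\langle T(Tf), Tf\rangle \le q\,\|f\|^2 \cdot q\,\|Tf\|^2$.
\<close>

lemma nrm_le_if_form_le:
  assumes T: "symmetric_op T" and pos: "\<And>f. f \<in> H \<Longrightarrow> 0 \<le> ip (T f) f"
    and le: "\<And>f. f \<in> H \<Longrightarrow> ip (T f) f \<le> q * ip f f" and "0 \<le> q" and f: "f \<in> H"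
  shows "nrm (T f) \<le> q * nrm f"
proof -
  note mem = linear_op_mem[OF symmetric_op_linear[OF T]]
  define a where "a = ip (T f) (T f)"
  have "a \<ge> 0" using mem f by (simp add: a_def)
  have "(ip (T f) (T f))\<^sup>2 \<le> ip (T f) f * ip (T (T f)) (T f)"
  proof (rule positive_form_Cauchy_Schwarz[of "\<lambda>f g. ip (T f) g"])
    fix f g :: "'a \<Rightarrow> real" and a b :: real assume fg: "f \<in> H" "g \<in> H"
    have "ip (T f) g = ip (T g) f" using fg mem T by (metis ip_commute symmetric_op_ip)
    then show "ip (T (lincomb a f b g)) (lincomb a f b g) =
         a * a * ip (T f) f + 2 * a * b * ip (T f) g + b * b * ip (T g) g"
      using fg by (simp add: linear_op_lincomb[OF symmetric_op_linear[OF T]] mem algebra_simps)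
  qed (use pos mem f in auto)
  also have "\<dots> \<le> (q * ip f f) * (q * a)"
    unfolding a_def using f mem pos le \<open>0 \<le> q\<close> by (intro mult_mono) auto
  finally have "a * a \<le> a * (q * q * ip f f)" by (simp add: a_def power2_eq_square mult_ac)
  then have "a \<le> (q * nrm f)\<^sup>2"
    using \<open>a \<ge> 0\<close> nrm_square[OF f]
    by (cases "a = 0") (auto simp: power2_eq_square mult_ac mult_le_cancel_left \<open>0 \<le> q\<close> f)
  then show ?thesis
    unfolding nrm_def[of "T f"] a_def using \<open>0 \<le> q\<close> f by (intro real_le_lsqrt) (auto simp: mem)
qed

lemma positive_opI:
  assumes T: "symmetric_op T" and pos: "\<And>f. f \<in> H \<Longrightarrow> 0 \<le> ip (T f) f"
    and le: "\<And>f. f \<in> H \<Longrightarrow> ip (T f) f \<le> M * ip f f"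
  shows "positive_op H ip T"
proof -
  have "ip (T f) f \<le> \<bar>M\<bar> * ip f f" if "f \<in> H" for f
    using le[OF that] mult_right_mono[OF abs_ge_self[of M] ip_nonneg[OF that]] by linarith
  then have "op_norm H ip T \<le> ennreal \<bar>M\<bar>"
    using nrm_le_if_form_le[OF T pos] by (intro op_norm_le) auto
  then have "op_norm H ip T < \<infinity>" by (simp add: order_le_less_trans)
  with T pos show ?thesis
    by (auto simp: positive_op_def symmetric_op_def linear_op_def lincomb_def)
qed

lemma positive_op_symmetric: "positive_op H ip T \<Longrightarrow> symmetric_op T"
  by (auto simp: positive_op_def symmetric_op_def linear_op_def lincomb_def)

lemma positive_op_nonneg: "positive_op H ip T \<Longrightarrow> f \<in> H \<Longrightarrow> 0 \<le> ip (T f) f"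
  unfolding positive_op_def by blast

lemma positive_op_bounded:
  assumes T: "positive_op H ip T"
  obtains M where "0 \<le> M" "\<And>f. f \<in> H \<Longrightarrow> ip (T f) f \<le> M * ip f f"
proof -
  have lin: "linear_op T" by (intro symmetric_op_linear positive_op_symmetric T)
  have "op_norm H ip T < \<infinity>" using T by (simp add: positive_op_def)
  then obtain M where M: "op_norm H ip T = ennreal M" "0 \<le> M"
    by (cases "op_norm H ip T") auto
  show ?thesis
  proof (rule that[OF M(2)])
    fix f assume f: "f \<in> H"
    have "ip (T f) f \<le> nrm (T f) * nrm f"
      using Cauchy_Schwarz[OF linear_op_mem[OF lin f] f] by simp
    also have "\<dots> \<le> (M * nrm f) * nrm f"
      using M f op_normD[OF lin _ M(2) f] by (intro mult_right_mono) auto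
    also have "\<dots> = M * ip f f" by (simp add: mult.assoc nrm_square[OF f])
    finally show "ip (T f) f \<le> M * ip f f" .
  qed
qed

section \<open>Square roots of coercive operators\<close>

text \<open>
  Banach's fixed point iteration for $u \mapsto g + Ku$.
\<close>

lemma contraction_solvable:
  assumes K: "linear_op K" and r: "0 \<le> r" "r < 1" and le: "\<And>f. f \<in> H \<Longrightarrow> nrm (K f) \<le> r * nrm f"
    and g: "g \<in> H"
  obtains u where "u \<in> H" "lincomb 1 u (-1) (K u) = g"
proof -
  define u where "u n = ((\<lambda>h. lincomb 1 g 1 (K h)) ^^ n) g" for n
  have u: "u n \<in> H" for n
    by (induction n) (auto simp: u_def g linear_op_mem[OF K])
  have uS: "u (Suc n) = lincomb 1 g 1 (K (u n))" for n by (simp add: u_def)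
  have dK: "dst (lincomb 1 g 1 (K f)) (lincomb 1 g 1 (K h)) \<le> r * dst f h" if "f \<in> H" "h \<in> H" for f h
  proof -
    have "lincomb 1 (lincomb 1 g 1 (K f)) (-1) (lincomb 1 g 1 (K h)) = lincomb 1 (K f) (-1) (K h)"
      by (simp add: lincomb_def)
    also have "\<dots> = K (lincomb 1 f (-1) h)" using that by (simp add: linear_op_lincomb[OF K])
    finally show ?thesis using that le by (simp add: dst_def)
  qed
  have "dst (u (Suc n)) (u n) \<le> dst (u 1) (u 0) * r ^ n" for n
  proof (induction n)
    case (Suc n)
    have "dst (u (Suc (Suc n))) (u (Suc n)) \<le> r * dst (u (Suc n)) (u n)"
      using dK[OF u[of "Suc n"] u[of n]] by (simp only: uS[of "Suc n"] uS[of n, symmetric])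
    also have "\<dots> \<le> r * (dst (u 1) (u 0) * r ^ n)" using r Suc.IH by (intro mult_left_mono) auto
    finally show ?case by (simp add: mult_ac)
  qed simp
  from geometric_limit[OF u r this] obtain v where v: "v \<in> H"
    "\<And>n. dst (u n) v \<le> dst (u 1) (u 0) * r ^ n / (1 - r)" by blast
  have Kv: "lincomb 1 g 1 (K v) \<in> H" using v g linear_op_mem[OF K] by simp
  have lim: "(\<lambda>n. dst (u 1) (u 0) * r ^ n / (1 - r)) \<longlonglongrightarrow> 0"
    using r by (auto intro!: tendsto_eq_intros LIMSEQ_realpow_zero)
  have "dst v (lincomb 1 g 1 (K v)) \<le> 0"
  proof (rule LIMSEQ_le_const)
    show "(\<lambda>n. dst (u 1) (u 0) * r ^ Suc n / (1 - r) + r * (dst (u 1) (u 0) * r ^ n / (1 - r))) \<longlonglongrightarrow> 0"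
      using tendsto_add[OF LIMSEQ_Suc[OF lim] tendsto_mult_left[OF lim, of r]] by simp
    have "dst v (lincomb 1 g 1 (K v)) \<le>
        dst (u 1) (u 0) * r ^ Suc n / (1 - r) + r * (dst (u 1) (u 0) * r ^ n / (1 - r))" for n
    proof -
      have "dst v (lincomb 1 g 1 (K v)) \<le> dst (u (Suc n)) v + dst (u (Suc n)) (lincomb 1 g 1 (K v))"
        using dst_triangle[OF v(1) u Kv, of "Suc n"] dst_commute[OF v(1) u, of "Suc n"] by simp
      also have "dst (u (Suc n)) (lincomb 1 g 1 (K v)) \<le> r * dst (u n) v"
        unfolding uS by (intro dK u v)
      also have "r * dst (u n) v \<le> r * (dst (u 1) (u 0) * r ^ n / (1 - r))"
        by (intro mult_left_mono v r)
      finally show ?thesis using v(2)[of "Suc n"] by linarith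
    qed
    then show "\<exists>N. \<forall>n\<ge>N. dst v (lincomb 1 g 1 (K v)) \<le>
        dst (u 1) (u 0) * r ^ Suc n / (1 - r) + r * (dst (u 1) (u 0) * r ^ n / (1 - r))" by blast
  qed
  then have "v = lincomb 1 g 1 (K v)"
    using eq_if_dst_0[OF v(1) Kv] dst_nonneg[OF v(1) Kv] by simp
  then have "lincomb 1 v (-1) (K v) = g" by (simp add: lincomb_def fun_eq_iff)
  with v(1) show ?thesis by (rule that)
qed

text \<open>
  The solution $Y = I - (I - T)^{1/2}$ of $2Y - Y^2 = T$ is the limit of
  $Y_{n+1} = (T + Y_n^2)/2$, $Y_0 = 0$. The number $r = 1 - \sqrt{1 - q}$ solves the same equation
  $q + r^2 = 2r$ for the norms: hence $\|Y_n\| \le r$ for all $n$, and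
  $Y_{n+1}^2 - Y_n^2 = Y_{n+1}(Y_{n+1} - Y_n) + (Y_{n+1} - Y_n)Y_n$ shows that consecutive iterates
  approach each other like $r^n$. Linearity and symmetry pass to the limit weakly, through the
  numbers $\langle Y_n f, g\rangle$.
\<close>

lemma contraction_sqrt_exists:
  assumes T: "symmetric_op T" and le: "\<And>f. f \<in> H \<Longrightarrow> nrm (T f) \<le> q * nrm f"
    and q: "0 \<le> q" "q < 1"
  obtains Y r where "symmetric_op Y" "0 \<le> r" "r < 1" "\<And>f. f \<in> H \<Longrightarrow> nrm (Y f) \<le> r * nrm f"
    "\<And>f. f \<in> H \<Longrightarrow> lincomb 2 (Y f) (-1) (Y (Y f)) = T f"
proof -
  define r where "r = 1 - sqrt (1 - q)"
  have r: "0 \<le> r" "r < 1" "q + r * r = 2 * r"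
    using q by (auto simp: r_def algebra_simps)
  note Tlin = symmetric_op_linear[OF T]
  define Y where "Y n = ((\<lambda>X f. lincomb (1/2) (T f) (1/2) (X (X f))) ^^ n) (\<lambda>f. lincomb 0 f 0 f)" for n
  have Y0: "Y 0 f = lincomb 0 f 0 f" for f by (simp add: Y_def)
  have YS: "Y (Suc n) f = lincomb (1/2) (T f) (1/2) (Y n (Y n f))" for n f by (simp add: Y_def)
  have Ymem: "Y n f \<in> H" if "f \<in> H" for n f
    using that by (induction n arbitrary: f) (auto simp: Y0 YS linear_op_mem[OF Tlin])
  have Ylin: "Y n (lincomb a f b g) = lincomb a (Y n f) b (Y n g)" if "f \<in> H" "g \<in> H" for n a b f g
    using that
  proof (induction n arbitrary: f g)
    case 0
    show ?case by (simp add: Y0 lincomb_def)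
  next
    case (Suc n)
    then show ?case by (simp add: YS Ymem linear_op_lincomb[OF Tlin]) (simp add: lincomb_def algebra_simps)
  qed
  have Ysym: "ip (Y n f) g = ip f (Y n g)" if "f \<in> H" "g \<in> H" for n f g
    using that
  proof (induction n arbitrary: f g)
    case (Suc n)
    then show ?case by (simp add: YS Ymem linear_op_mem[OF Tlin] symmetric_op_ip[OF T])
  qed (simp add: Y0)
  have Yle: "nrm (Y n f) \<le> r * nrm f" if "f \<in> H" for n f
    using that
  proof (induction n arbitrary: f)
    case 0
    then show ?case using nrm_lincomb_le[of f f 0 0] r by (simp add: Y0 order_trans)
  next
    case (Suc n)
    have "nrm (Y (Suc n) f) \<le> 1/2 * nrm (T f) + 1/2 * nrm (Y n (Y n f))"
      using Suc.prems nrm_lincomb_le[of "T f" "Y n (Y n f)" "1/2" "1/2"]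
      by (simp add: YS Ymem linear_op_mem[OF Tlin])
    also have "\<dots> \<le> 1/2 * (q * nrm f) + 1/2 * (r * (r * nrm f))"
      using Suc le r by (intro add_mono mult_left_mono order_trans[OF Suc.IH[OF Ymem]] ) auto
    also have "\<dots> = 1/2 * (q + r * r) * nrm f" by (simp add: algebra_simps)
    also have "\<dots> = r * nrm f" by (simp add: r(3))
    finally show ?case .
  qed
  have step: "dst (Y (Suc n) f) (Y n f) \<le> nrm f * r ^ n" if "f \<in> H" for n f
    using that
  proof (induction n arbitrary: f)
    case 0
    have "dst (Y (Suc 0) f) (Y 0 f) \<le> 1/2 * (q * nrm f)"
    proof -
      have "lincomb 1 (Y (Suc 0) f) (-1) (Y 0 f) = lincomb (1/2) (T f) 0 f"
        by (simp only: YS Y0) (simp add: lincomb_def)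
      then show ?thesis
        using nrm_lincomb_le[of "T f" f "1/2" 0] le[OF 0] 0 by (simp add: dst_def linear_op_mem[OF Tlin])
    qed
    also have "\<dots> \<le> nrm f" using q mult_right_mono[of q 1 "nrm f"] nrm_nonneg[OF 0] by simp
    finally show ?case by simp
  next
    case (Suc n)
    let ?d = "lincomb 1 (Y (Suc n) f) (-1) (Y n f)"
    let ?e = "lincomb 1 (Y (Suc n) (Y n f)) (-1) (Y n (Y n f))"
    have e1: "Y (Suc (Suc n)) f x = T f x / 2 + Y (Suc n) (Y (Suc n) f) x / 2" for x
      by (subst YS) (simp add: lincomb_def)
    have e2: "Y (Suc n) f x = T f x / 2 + Y n (Y n f) x / 2" for x
      by (subst YS) (simp add: lincomb_def)
    have "lincomb 1 (Y (Suc (Suc n)) f) (-1) (Y (Suc n) f) =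
        lincomb (1/2) (lincomb 1 (Y (Suc n) (Y (Suc n) f)) (-1) (Y (Suc n) (Y n f))) (1/2) ?e"
      by (rule ext) (simp add: lincomb_def e1 e2 field_simps)
    also have "lincomb 1 (Y (Suc n) (Y (Suc n) f)) (-1) (Y (Suc n) (Y n f)) = Y (Suc n) ?d"
      using Suc.prems by (simp add: Ylin Ymem)
    finally have "dst (Y (Suc (Suc n)) f) (Y (Suc n) f) \<le> 1/2 * nrm (Y (Suc n) ?d) + 1/2 * nrm ?e"
      using Suc.prems nrm_lincomb_le[of "Y (Suc n) ?d" ?e "1/2" "1/2"] by (simp add: dst_def Ymem)
    also have "nrm (Y (Suc n) ?d) \<le> r * (nrm f * r ^ n)"
    proof -
      have "nrm (Y (Suc n) ?d) \<le> r * nrm ?d" using Suc.prems by (intro Yle) (simp add: Ymem)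
      also have "\<dots> \<le> r * (nrm f * r ^ n)"
        using Suc.IH[OF Suc.prems] r by (intro mult_left_mono) (auto simp: dst_def)
      finally show ?thesis .
    qed
    also have "nrm ?e \<le> (r * nrm f) * r ^ n"
    proof -
      have "nrm ?e \<le> nrm (Y n f) * r ^ n"
        using Suc.IH[OF Ymem[OF Suc.prems]] by (simp add: dst_def)
      also have "\<dots> \<le> (r * nrm f) * r ^ n"
        using Yle[OF Suc.prems] r by (intro mult_right_mono) auto
      finally show ?thesis .
    qed
    finally show ?case by (simp add: mult_ac)
  qed
  define Z where "Z f = (SOME g. g \<in> H \<and> (\<forall>n. dst (Y n f) g \<le> nrm f * r ^ n / (1 - r)))" for f
  have Z: "Z f \<in> H" "dst (Y n f) (Z f) \<le> nrm f * r ^ n / (1 - r)" if "f \<in> H" for f n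
  proof -
    have "\<exists>g. g \<in> H \<and> (\<forall>n. dst (Y n f) g \<le> nrm f * r ^ n / (1 - r))"
      using geometric_limit[OF Ymem[OF that] r(1,2) step[OF that]] by blast
    from someI_ex[OF this] show "Z f \<in> H" "dst (Y n f) (Z f) \<le> nrm f * r ^ n / (1 - r)"
      unfolding Z_def by blast+
  qed
  have lim0: "(\<lambda>n. C * r ^ n / (1 - r)) \<longlonglongrightarrow> 0" for C
    using r by (auto intro!: tendsto_eq_intros LIMSEQ_realpow_zero)
  \<comment> \<open>The second argument may vary with \<open>n\<close>, since the limit of $\langle Y_n f, Y_n g\rangle$ is needed for $Y^2$.\<close>
  have Zlim: "(\<lambda>n. ip (Y n f) (g n)) \<longlonglongrightarrow> l"
    if f: "f \<in> H" and g: "\<And>n. g n \<in> H" "\<And>n. nrm (g n) \<le> C" and l: "(\<lambda>n. ip (Z f) (g n)) \<longlonglongrightarrow> l"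
    for f g C l
  proof -
    have "(\<lambda>n. ip (Y n f) (g n) - ip (Z f) (g n)) \<longlonglongrightarrow> 0"
    proof (rule Lim_null_comparison[OF _ lim0[of "C * nrm f"]], rule always_eventually, rule allI)
      fix n
      have C: "C \<ge> 0" using nrm_nonneg[OF g(1)[of 0]] g(2)[of 0] by linarith
      have "ip (Y n f) (g n) - ip (Z f) (g n) = ip (lincomb 1 (Y n f) (-1) (Z f)) (g n)"
        using f g Z Ymem by simp
      then have "norm (ip (Y n f) (g n) - ip (Z f) (g n)) \<le> dst (Y n f) (Z f) * nrm (g n)"
        using Cauchy_Schwarz[of "lincomb 1 (Y n f) (-1) (Z f)" "g n"] f g Z Ymem by (simp add: dst_def)
      also have "\<dots> \<le> (nrm f * r ^ n / (1 - r)) * C"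
        using f g Z Ymem C r by (intro mult_mono) auto
      finally show "norm (ip (Y n f) (g n) - ip (Z f) (g n)) \<le> C * nrm f * r ^ n / (1 - r)"
        by (simp add: mult_ac)
    qed
    from tendsto_add[OF this l] show ?thesis by simp
  qed
  have Zweak: "(\<lambda>n. ip (Y n f) g) \<longlonglongrightarrow> ip (Z f) g" if "f \<in> H" "g \<in> H" for f g
    using that by (intro Zlim[of _ _ "nrm g"]) auto
  have Zlin: "linear_op Z"
    unfolding linear_op_def
  proof (intro conjI ballI allI Z)
    fix f g :: "'a \<Rightarrow> real" and a b :: real assume fg: "f \<in> H" "g \<in> H"
    show "Z (lincomb a f b g) = lincomb a (Z f) b (Z g)"
    proof (rule weak_eqI)
      fix h assume h: "h \<in> H"
      have "(\<lambda>n. ip (Y n (lincomb a f b g)) h) \<longlonglongrightarrow> a * ip (Z f) h + b * ip (Z g) h"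
        using fg h by (auto simp: Ylin Ymem intro!: tendsto_intros Zweak)
      then have "ip (Z (lincomb a f b g)) h = a * ip (Z f) h + b * ip (Z g) h"
        using Zweak[OF lincomb_mem[OF fg] h] by (rule LIMSEQ_unique[rotated])
      then show "ip (Z (lincomb a f b g)) h = ip (lincomb a (Z f) b (Z g)) h"
        using fg h Z by simp
    qed (use fg Z in auto)
  qed auto
  have Zsym: "ip (Z f) g = ip f (Z g)" if "f \<in> H" "g \<in> H" for f g
  proof -
    have "ip (Y n f) g = ip (Y n g) f" for n
      using Ysym[OF that] ip_commute[OF that(1) Ymem[OF that(2)]] by simp
    then have "(\<lambda>n. ip (Y n f) g) \<longlonglongrightarrow> ip (Z g) f"
      using Zweak[OF that(2,1)] by simp
    from LIMSEQ_unique[OF Zweak[OF that] this] show ?thesis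
      using ip_commute[OF that(1) Z(1)[OF that(2)]] by simp
  qed
  have Zle: "nrm (Z f) \<le> r * nrm f" if f: "f \<in> H" for f
  proof -
    have "ip (Z f) (Z f) \<le> r * nrm f * nrm (Z f)"
    proof (rule LIMSEQ_le_const2[OF Zweak[OF f Z(1)[OF f]]])
      have "ip (Y n f) (Z f) \<le> r * nrm f * nrm (Z f)" for n
        using Cauchy_Schwarz[OF Ymem[OF f] Z(1)[OF f], of n]
          mult_right_mono[OF Yle[OF f] nrm_nonneg[OF Z(1)[OF f]], of n] by linarith
      then show "\<exists>N. \<forall>n\<ge>N. ip (Y n f) (Z f) \<le> r * nrm f * nrm (Z f)" by blast
    qed
    then have "nrm (Z f) * nrm (Z f) \<le> r * nrm f * nrm (Z f)"
      by (simp add: nrm_square Z f)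
    then show ?thesis
      using nrm_nonneg[OF Z(1)[OF f]] r f by (cases "nrm (Z f) = 0") (auto simp: mult_le_cancel_right)
  qed
  have Zeq: "lincomb 2 (Z f) (-1) (Z (Z f)) = T f" if f: "f \<in> H" for f
  proof (rule weak_eqI)
    fix g assume g: "g \<in> H"
    have "(\<lambda>n. ip (Z f) (Y n g)) \<longlonglongrightarrow> ip (Z f) (Z g)"
      using Zweak[OF g Z(1)[OF f]]
      by (simp only: ip_commute[OF Z(1)[OF f] Ymem[OF g]] ip_commute[OF Z(1)[OF f] Z(1)[OF g]])
    moreover have "nrm (Y n g) \<le> r * nrm g" for n by (rule Yle[OF g])
    ultimately have "(\<lambda>n. ip (Y n f) (Y n g)) \<longlonglongrightarrow> ip (Z f) (Z g)"
      using f g by (intro Zlim[of f "\<lambda>n. Y n g"]) (auto simp: Ymem)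
    then have "(\<lambda>n. 1/2 * ip (T f) g + 1/2 * ip (Y n f) (Y n g)) \<longlonglongrightarrow> 1/2 * ip (T f) g + 1/2 * ip (Z f) (Z g)"
      by (intro tendsto_intros)
    moreover have "ip (Y (Suc n) f) g = 1/2 * ip (T f) g + 1/2 * ip (Y n f) (Y n g)" for n
      using f g by (simp add: YS Ymem linear_op_mem[OF Tlin] Ysym)
    ultimately have "(\<lambda>n. ip (Y (Suc n) f) g) \<longlonglongrightarrow> 1/2 * ip (T f) g + 1/2 * ip (Z f) (Z g)" by simp
    from LIMSEQ_unique[OF LIMSEQ_Suc[OF Zweak[OF f g]] this]
    show "ip (lincomb 2 (Z f) (-1) (Z (Z f))) g = ip (T f) g"
      using f g by (simp add: Z Zsym)
  qed (use f Z linear_op_mem[OF Tlin] in auto)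
  show ?thesis
    by (rule that[OF _ r(1,2) Zle Zeq]) (simp_all add: symmetric_op_def Zlin Zsym)
qed

definition coercive_op :: "(('a \<Rightarrow> real) \<Rightarrow> 'a \<Rightarrow> real) \<Rightarrow> bool" where
  "coercive_op A \<longleftrightarrow> positive_op H ip A \<and> (\<exists>l>0. \<forall>f\<in>H. l * ip f f \<le> ip (A f) f)"

text \<open>
  If $l \le A \le M$ as forms, then $T = I - A/M$ satisfies $0 \le T \le 1 - l/M < 1$, and
  $S = \sqrt M\,(I - Y)$ with $2Y - Y^2 = T$ is a square root of $A$. Since $\|Y\| < 1$, the operator
  $S$ is onto, and therefore so is $A = S^2$.
\<close>

lemma coercive_sqrt_exists:
  assumes A: "coercive_op A"
  shows "\<exists>S. positive_op H ip S \<and> (\<forall>f\<in>H. S (S f) = A f)"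
    and "A ` H = H"
proof -
  obtain l where l: "l > 0" "\<And>f. f \<in> H \<Longrightarrow> l * ip f f \<le> ip (A f) f"
    using A by (auto simp: coercive_op_def)
  have Asym: "symmetric_op A" using A positive_op_symmetric by (auto simp: coercive_op_def)
  note Alin = symmetric_op_linear[OF Asym]
  obtain M' where M': "\<And>f. f \<in> H \<Longrightarrow> ip (A f) f \<le> M' * ip f f"
    using A positive_op_bounded[of A] by (metis coercive_op_def)
  \<comment> \<open>Taking the maximum with \<open>l\<close> keeps $1 - l/M$ nonnegative even if \<open>H\<close> is trivial.\<close>
  define M where "M = max M' l"
  have "M > 0" "M \<ge> l" using l by (auto simp: M_def)
  have M: "ip (A f) f \<le> M * ip f f" if "f \<in> H" for f
    using M'[OF that] mult_right_mono[OF max.cobounded1[of M' l] ip_nonneg[OF that]]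
    by (simp add: M_def)
  define T where "T f = lincomb 1 f (- 1 / M) (A f)" for f
  have Tlin: "linear_op T"
    unfolding linear_op_def T_def
    by (auto simp: linear_op_mem[OF Alin] linear_op_lincomb[OF Alin]) (simp add: lincomb_def algebra_simps diff_divide_distrib add_divide_distrib)
  have Tsym: "symmetric_op T"
    unfolding symmetric_op_def
    by (auto simp: Tlin) (simp add: T_def linear_op_mem[OF Alin] symmetric_op_ip[OF Asym])
  have Tip: "ip (T f) f = ip f f - ip (A f) f / M" if "f \<in> H" for f
    using that by (simp add: T_def linear_op_mem[OF Alin])
  have "nrm (T f) \<le> (1 - l / M) * nrm f" if "f \<in> H" for f
  proof (rule nrm_le_if_form_le[OF Tsym _ _ _ that])
    fix f assume f: "f \<in> H"
    show "0 \<le> ip (T f) f" using M[OF f] \<open>M > 0\<close> by (simp add: Tip f field_simps)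
    show "ip (T f) f \<le> (1 - l / M) * ip f f" using l(2)[OF f] \<open>M > 0\<close> by (simp add: Tip f field_simps)
  qed (use l \<open>M > 0\<close> \<open>M \<ge> l\<close> in simp)
  moreover have "0 \<le> 1 - l / M" "1 - l / M < 1" using l \<open>M > 0\<close> \<open>M \<ge> l\<close> by simp_all
  ultimately obtain Y r where Y: "symmetric_op Y" "0 \<le> r" "r < 1" 
    "\<And>f. f \<in> H \<Longrightarrow> nrm (Y f) \<le> r * nrm f"
    "\<And>f. f \<in> H \<Longrightarrow> lincomb 2 (Y f) (-1) (Y (Y f)) = T f"
    using contraction_sqrt_exists[OF Tsym, of "1 - l / M"] by metis
  note Ylin = symmetric_op_linear[OF Y(1)]
  define S where "S f = lincomb (sqrt M) f (- sqrt M) (Y f)" for f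
  have Slin: "linear_op S"
    unfolding linear_op_def S_def
    by (auto simp: linear_op_mem[OF Ylin] linear_op_lincomb[OF Ylin]) (simp add: lincomb_def algebra_simps)
  have Ssym: "symmetric_op S"
    unfolding symmetric_op_def
    by (auto simp: Slin) (simp add: S_def linear_op_mem[OF Ylin] symmetric_op_ip[OF Y(1)])
  have Yform: "\<bar>ip (Y f) f\<bar> \<le> r * ip f f" if f: "f \<in> H" for f
  proof -
    have "\<bar>ip (Y f) f\<bar> \<le> nrm (Y f) * nrm f" by (intro Cauchy_Schwarz linear_op_mem[OF Ylin] f)
    also have "\<dots> \<le> (r * nrm f) * nrm f" using Y f by (intro mult_right_mono) auto
    finally show ?thesis by (simp add: mult.assoc nrm_square[OF f])
  qed
  have Sip: "ip (S f) f = sqrt M * (ip f f - ip (Y f) f)" if "f \<in> H" for f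
    using that by (simp add: S_def linear_op_mem[OF Ylin] algebra_simps)
  have Spos: "positive_op H ip S"
  proof (rule positive_opI[OF Ssym, of "sqrt M * (1 + r)"])
    fix f assume f: "f \<in> H"
    have "r * ip f f \<le> ip f f" using mult_right_mono[of r 1 "ip f f"] Y f by simp
    then show "0 \<le> ip (S f) f" using Yform[OF f] \<open>M > 0\<close> by (simp add: Sip f)
    show "ip (S f) f \<le> sqrt M * (1 + r) * ip f f"
      using mult_left_mono[of "ip f f - ip (Y f) f" "(1 + r) * ip f f" "sqrt M"] Yform[OF f] \<open>M > 0\<close>
      by (simp add: Sip f ring_distribs mult.assoc)
  qed
  have SS: "S (S f) = A f" if f: "f \<in> H" for f
  proof -
    have sM: "sqrt M * (sqrt M * z) = M * z" for z using \<open>M > 0\<close> by (simp flip: mult.assoc)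
    have "S (S f) = lincomb M (lincomb 1 f (-1) (lincomb 2 (Y f) (-1) (Y (Y f)))) 0 f"
      unfolding S_def using f \<open>M > 0\<close>
      by (simp add: linear_op_lincomb[OF Ylin] linear_op_mem[OF Ylin]) (simp add: lincomb_def algebra_simps sM)
    also have "\<dots> = lincomb M (lincomb 1 f (-1) (T f)) 0 f" using Y(5)[OF f] by simp
    also have "\<dots> = A f" using \<open>M > 0\<close> by (simp add: T_def lincomb_def algebra_simps)
    finally show ?thesis .
  qed
  have Sonto: "\<exists>u\<in>H. S u = g" if g: "g \<in> H" for g
  proof -
    have "lincomb (1 / sqrt M) g 0 g \<in> H" using g by simp
    from contraction_solvable[OF Ylin Y(2,3) Y(4) this]
    obtain u where u: "u \<in> H" "lincomb 1 u (- 1) (Y u) = lincomb (1 / sqrt M) g 0 g" by blast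
    have "S u = lincomb (sqrt M) (lincomb 1 u (- 1) (Y u)) 0 u"
      by (simp add: S_def lincomb_def algebra_simps)
    also have "\<dots> = g" unfolding u(2) using \<open>M > 0\<close> by (simp add: lincomb_def)
    finally show ?thesis using u(1) by blast
  qed
  show "\<exists>S. positive_op H ip S \<and> (\<forall>f\<in>H. S (S f) = A f)" using Spos SS by blast
  show "A ` H = H"
  proof
    show "A ` H \<subseteq> H" using linear_op_mem[OF Alin] by blast
    show "H \<subseteq> A ` H"
    proof
      fix g assume "g \<in> H"
      then obtain u v where "u \<in> H" "S u = g" "v \<in> H" "S v = u" using Sonto by metis
      then show "g \<in> A ` H" using SS by blast
    qed
  qed
qed

context
  fixes A assumes A: "coercive_op A"
begin

lemma coercive_op_nonneg: "f \<in> H \<Longrightarrow> 0 \<le> ip (A f) f"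
  using A positive_op_nonneg by (auto simp: coercive_op_def)

lemma op_sqrt_positive: "positive_op H ip (op_sqrt H ip A)"
  and op_sqrt_square: "f \<in> H \<Longrightarrow> op_sqrt H ip A (op_sqrt H ip A f) = A f"
  using someI_ex[OF coercive_sqrt_exists(1)[OF A]] by (auto simp: op_sqrt_def)

lemma op_sqrt_symmetric: "symmetric_op (op_sqrt H ip A)"
  by (intro positive_op_symmetric op_sqrt_positive)

lemma op_sqrt_mem [simp]: "f \<in> H \<Longrightarrow> op_sqrt H ip A f \<in> H"
  by (rule linear_op_mem[OF symmetric_op_linear[OF op_sqrt_symmetric]])

lemma ip_op_sqrt: "f \<in> H \<Longrightarrow> ip (op_sqrt H ip A f) (op_sqrt H ip A f) = ip (A f) f"
  using symmetric_op_ip[OF op_sqrt_symmetric, of "op_sqrt H ip A f" f] by (simp add: op_sqrt_square)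

text \<open>
  The square root $S$ of $A$ is injective because $\|Sh\|^2 = \langle Ah, h\rangle$ is coercive, and onto because $A$ is.
\<close>

lemma bij_betw_op_sqrt: "bij_betw (op_sqrt H ip A) H H"
proof (rule bij_betw_imageI)
  let ?S = "op_sqrt H ip A"
  note lin = symmetric_op_linear[OF op_sqrt_symmetric]
  show "inj_on ?S H"
  proof (rule inj_onI)
    fix f g assume fg: "f \<in> H" "g \<in> H" "?S f = ?S g"
    define h where "h = lincomb 1 f (-1) g"
    have h: "h \<in> H" using fg by (simp add: h_def)
    have "?S h = lincomb 1 (?S f) (-1) (?S g)"
      unfolding h_def using fg by (intro linear_op_lincomb[OF lin])
    then have "?S h = (\<lambda>_. 0)" using fg(3) by (simp add: lincomb_def)
    then have "ip (A h) h = 0" using ip_op_sqrt[OF h] nrm_zero by (simp add: nrm_def)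
    moreover obtain l where "l > 0" "l * ip h h \<le> ip (A h) h"
      using A h by (auto simp: coercive_op_def)
    ultimately have "ip h h \<le> 0" by (simp add: mult_le_0_iff)
    then show "f = g"
      using eq_if_dst_0[OF fg(1,2)] ip_nonneg[OF h] by (simp add: dst_def nrm_def h_def)
  qed
  have "H = ?S ` ?S ` H"
    using coercive_sqrt_exists(2)[OF A] op_sqrt_square by (auto simp: image_image cong: image_cong)
  then show "?S ` H = H" using op_sqrt_mem by (metis (no_types, lifting) image_mono image_subsetI subset_antisym)
qed

lemma op_inv_sqrt_mem [simp]: "f \<in> H \<Longrightarrow> op_inv_sqrt H ip A f \<in> H"
  unfolding op_inv_sqrt_def using bij_betw_op_sqrt by (metis bij_betw_def inv_into_into)

lemma op_sqrt_inv_sqrt [simp]: "f \<in> H \<Longrightarrow> op_sqrt H ip A (op_inv_sqrt H ip A f) = f"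
  unfolding op_inv_sqrt_def using bij_betw_op_sqrt by (metis bij_betw_def f_inv_into_f)

lemma op_inv_sqrt_sqrt [simp]: "f \<in> H \<Longrightarrow> op_inv_sqrt H ip A (op_sqrt H ip A f) = f"
  unfolding op_inv_sqrt_def using bij_betw_op_sqrt by (metis bij_betw_def inv_into_f_f)

lemma op_inv_sqrt_symmetric: "symmetric_op (op_inv_sqrt H ip A)"
proof -
  let ?S = "op_sqrt H ip A" and ?R = "op_inv_sqrt H ip A"
  note lin = symmetric_op_linear[OF op_sqrt_symmetric]
  have "?R (lincomb a f b g) = lincomb a (?R f) b (?R g)" if "f \<in> H" "g \<in> H" for a b f g
  proof -
    have "?S (lincomb a (?R f) b (?R g)) = lincomb a f b g"
      using that by (simp add: linear_op_lincomb[OF lin])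
    then show ?thesis using that op_inv_sqrt_sqrt[of "lincomb a (?R f) b (?R g)"] by simp
  qed
  moreover have "ip (?R f) g = ip f (?R g)" if "f \<in> H" "g \<in> H" for f g
    using symmetric_op_ip[OF op_sqrt_symmetric, of "?R f" "?R g"] that by simp
  ultimately show ?thesis by (simp add: symmetric_op_def linear_op_def)
qed

lemma ip_op_inv_sqrt:
  "f \<in> H \<Longrightarrow> ip (A (op_inv_sqrt H ip A f)) (op_inv_sqrt H ip A f) = ip f f"
  using ip_op_sqrt[of "op_inv_sqrt H ip A f"] by simp

text \<open>
  With $g = A^{1/2}h$ one has
  $\langle Eh, h\rangle = \langle A^{-1/2}EA^{-1/2}g, g\rangle$ and $\|g\|^2 = \langle Ah, h\rangle$.
\<close>

lemma form_bound_if_sandwiched_norm: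
  assumes E: "linear_op E" and "0 \<le> c"
    and le: "op_norm H ip (op_inv_sqrt H ip A \<circ> E \<circ> op_inv_sqrt H ip A) \<le> ennreal c"
    and h: "h \<in> H"
  shows "\<bar>ip (E h) h\<bar> \<le> c * ip (A h) h"
proof -
  let ?S = "op_sqrt H ip A" and ?R = "op_inv_sqrt H ip A"
  define g where "g = ?S h"
  have g: "g \<in> H" "?R g = h" using h by (simp_all add: g_def)
  note Rlin = symmetric_op_linear[OF op_inv_sqrt_symmetric]
  have lin: "linear_op (?R \<circ> E \<circ> ?R)"
    using Rlin E by (simp add: linear_op_def)
  have mem: "E h \<in> H" using linear_op_mem[OF E h] .
  have "ip (E h) h = ip (?R (E h)) g"
    using symmetric_op_ip[OF op_inv_sqrt_symmetric mem g(1)] g(2) by simp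
  then have "\<bar>ip (E h) h\<bar> \<le> nrm (?R (E h)) * nrm g"
    using Cauchy_Schwarz[OF op_inv_sqrt_mem[OF mem] g(1)] by simp
  also have "\<dots> \<le> (c * nrm g) * nrm g"
    using op_normD[OF lin le \<open>0 \<le> c\<close> g(1)] g nrm_nonneg[OF g(1)] by (intro mult_right_mono) simp_all
  also have "\<dots> = c * ip (A h) h"
    by (simp add: mult.assoc nrm_square[OF g(1)]) (simp add: g_def ip_op_sqrt[OF h])
  finally show ?thesis .
qed

end

section \<open>Comparison of two coercive operators\<close>

lemma op_norm_sqrt_inv_sqrt_le:
  assumes A: "coercive_op A" and B: "coercive_op B" and "0 \<le> K"
    and le: "\<And>h. h \<in> H \<Longrightarrow> ip (A h) h \<le> K * ip (B h) h"
  shows "op_norm H ip (op_sqrt H ip A \<circ> op_inv_sqrt H ip B) \<le> ennreal (sqrt K)"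
proof (rule op_norm_le)
  fix f assume f: "f \<in> H"
  define h where "h = op_inv_sqrt H ip B f"
  have h: "h \<in> H" using f op_inv_sqrt_mem[OF B] by (simp add: h_def)
  have "ip (op_sqrt H ip A h) (op_sqrt H ip A h) \<le> K * ip f f"
    using le[OF h] ip_op_sqrt[OF A h] ip_op_inv_sqrt[OF B f] by (simp add: h_def)
  then show "nrm ((op_sqrt H ip A \<circ> op_inv_sqrt H ip B) f) \<le> sqrt K * nrm f"
    by (simp add: nrm_def h_def flip: real_sqrt_mult)
qed (use \<open>0 \<le> K\<close> in simp)

text \<open>
  The form inequality bounds the adjoint $B^{1/2}A^{-1/2}$. With $u = A^{-1/2}B^{1/2}f$, the bound is
  transferred by $\|u\|^2 = \langle f, B^{1/2}A^{-1/2}u\rangle \le \|f\|\,\sqrt K\,\|u\|$.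
\<close>

lemma op_norm_inv_sqrt_sqrt_le:
  assumes A: "coercive_op A" and B: "coercive_op B" and "0 \<le> K"
    and le: "\<And>h. h \<in> H \<Longrightarrow> ip (B h) h \<le> K * ip (A h) h"
  shows "op_norm H ip (op_inv_sqrt H ip A \<circ> op_sqrt H ip B) \<le> ennreal (sqrt K)"
proof (rule op_norm_le)
  fix f assume f: "f \<in> H"
  define u where "u = op_inv_sqrt H ip A (op_sqrt H ip B f)"
  define v where "v = op_sqrt H ip B (op_inv_sqrt H ip A u)"
  note mem = op_sqrt_mem[OF B] op_inv_sqrt_mem[OF A]
  have u: "u \<in> H" and v: "v \<in> H" using f mem by (simp_all add: u_def v_def)
  have "ip u u = ip (op_sqrt H ip B f) (op_inv_sqrt H ip A u)"
    using symmetric_op_ip[OF op_inv_sqrt_symmetric[OF A] mem(1)[OF f] u] by (simp add: u_def)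
  also have "\<dots> = ip f v"
    unfolding v_def by (rule symmetric_op_ip[OF op_sqrt_symmetric[OF B] f mem(2)[OF u]])
  also have "\<dots> \<le> nrm f * nrm v" using Cauchy_Schwarz[OF f v] by simp
  also have "\<dots> \<le> nrm f * (sqrt K * nrm u)"
  proof (rule mult_left_mono)
    show "nrm v \<le> sqrt K * nrm u"
      using le[OF mem(2)[OF u]] ip_op_sqrt[OF B mem(2)[OF u]] ip_op_inv_sqrt[OF A u]
      by (simp add: nrm_def v_def flip: real_sqrt_mult)
  qed (use f in simp)
  finally have "nrm u * nrm u \<le> (sqrt K * nrm f) * nrm u"
    by (simp add: nrm_square u mult_ac)
  then have "nrm u \<le> sqrt K * nrm f"
    using nrm_nonneg[OF u] f \<open>0 \<le> K\<close> by (cases "nrm u = 0") (auto simp: mult_le_cancel_right)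
  then show "nrm ((op_inv_sqrt H ip A \<circ> op_sqrt H ip B) f) \<le> sqrt K * nrm f"
    by (simp add: u_def)
qed (use \<open>0 \<le> K\<close> in simp)

lemma coercive_op_shift:
  assumes T: "positive_op H ip T" and "l > 0"
  shows "coercive_op (op_shift T l)"
proof -
  note sym = positive_op_symmetric[OF T]
  note lin = symmetric_op_linear[OF sym]
  have eq: "op_shift T l = (\<lambda>f. lincomb 1 (T f) l f)"
    by (simp add: op_shift_def lincomb_def fun_eq_iff)
  have "linear_op (op_shift T l)"
    unfolding linear_op_def eq
    by (auto simp: linear_op_mem[OF lin] linear_op_lincomb[OF lin]) (simp add: lincomb_def algebra_simps)
  then have s: "symmetric_op (op_shift T l)"
    unfolding symmetric_op_def by (auto simp: eq linear_op_mem[OF lin] symmetric_op_ip[OF sym])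
  have form: "ip (op_shift T l f) f = ip (T f) f + l * ip f f" if "f \<in> H" for f
    using that by (simp add: eq linear_op_mem[OF lin])
  obtain M where M: "\<And>f. f \<in> H \<Longrightarrow> ip (T f) f \<le> M * ip f f"
    using positive_op_bounded[OF T] by blast
  have "positive_op H ip (op_shift T l)"
    using M positive_op_nonneg[OF T] \<open>l > 0\<close>
    by (intro positive_opI[OF s, of "M + l"]) (auto simp: form algebra_simps)
  then show ?thesis
    using positive_op_nonneg[OF T] \<open>l > 0\<close> by (auto simp: coercive_op_def form)
qed

lemma ip_op_shift:
  assumes "positive_op H ip T" "f \<in> H"
  shows "ip (op_shift T l f) f = ip (T f) f + l * ip f f"
proof -
  have "op_shift T l f = lincomb 1 (T f) l f" by (simp add: op_shift_def lincomb_def)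
  then show ?thesis
    using assms linear_op_mem[OF symmetric_op_linear[OF positive_op_symmetric]] by simp
qed

lemma linear_op_diff:
  assumes S: "linear_op S" and T: "linear_op T"
  shows "linear_op (op_diff S T)"
proof -
  have "op_diff S T = (\<lambda>f. lincomb 1 (S f) (-1) (T f))"
    by (simp add: op_diff_def lincomb_def fun_eq_iff)
  then show ?thesis
    unfolding linear_op_def
    by (auto simp: linear_op_mem[OF S] linear_op_mem[OF T] linear_op_lincomb[OF S] linear_op_lincomb[OF T])
      (simp add: lincomb_def algebra_simps)
qed

end

section \<open>The native space as a Hilbert space\<close>

locale spherical_kernel = rotation_invariant \<omega>
  for \<omega> :: "(real ^ 'n) measure" +
  fixes Z :: "nat \<Rightarrow> nat"
    and Y :: "nat \<Rightarrow> nat \<Rightarrow> (real ^ 'n) \<Rightarrow> real"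
    and \<phi> :: "real \<Rightarrow> real"
    and \<phi>h :: "nat \<Rightarrow> real"
  assumes dim: "CARD('n) \<ge> 2"
    and basis: "orthonormal_harmonic_bases \<omega> Z Y"
    and kernel: "spherical_basis_function Z Y \<phi> \<phi>h"
begin

abbreviation coeff :: "((real ^ 'n) \<Rightarrow> real) \<Rightarrow> nat \<Rightarrow> nat \<Rightarrow> real" where
  "coeff \<equiv> fcoeff \<omega> Y"

abbreviation N :: "((real ^ 'n) \<Rightarrow> real) set" where
  "N \<equiv> native_fun \<omega> Z Y \<phi>h"

abbreviation nip :: "((real ^ 'n) \<Rightarrow> real) \<Rightarrow> ((real ^ 'n) \<Rightarrow> real) \<Rightarrow> real" where
  "nip \<equiv> native_inner \<omega> Z Y \<phi>h"

text \<open>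
  Series are grouped by degree, as the expansions in the native space are summed over full degrees;
  \<open>weight\<close> is the share of each degree in the square of the native norm.
\<close>

definition block :: "(nat \<Rightarrow> nat \<Rightarrow> real) \<Rightarrow> real ^ 'n \<Rightarrow> nat \<Rightarrow> real" where
  "block a x k = (\<Sum>l=1..Z k. a k l * Y k l x)"

definition weight :: "(nat \<Rightarrow> nat \<Rightarrow> real) \<Rightarrow> nat \<Rightarrow> real" where
  "weight a k = inverse (\<phi>h k) * (\<Sum>l=1..Z k. (a k l)\<^sup>2)"

lemma \<phi>h_pos [simp]: "\<phi>h k > 0"
  using kernel by (simp add: spherical_basis_function_def)

lemma \<phi>h_neq_0 [simp]: "\<phi>h k \<noteq> 0"
  by (metis \<phi>h_pos less_irrefl)

lemma weight_nonneg [simp]: "weight a k \<ge> 0"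
  using \<phi>h_pos[of k] by (simp add: weight_def sum_nonneg less_imp_le)

lemma harmonic_polynomial:
  assumes "l \<in> {1..Z k}"
  obtains p where "Y k l = sphere_fun p" "real_polynomial_function p"
    "\<forall>c x. p (c *\<^sub>R x) = c ^ k * p x" "\<forall>x. laplacian p x = 0"
  using basis assms unfolding orthonormal_harmonic_bases_def spherical_harmonics_def by blast

text \<open>
  All functions that are integrated below are bounded, which makes integrability of their products
  automatic.
\<close>

definition bounded_measurable :: "((real ^ 'n) \<Rightarrow> real) \<Rightarrow> bool" where
  "bounded_measurable f \<longleftrightarrow> f \<in> borel_measurable \<omega> \<and> (\<exists>B. \<forall>x\<in>usphere. \<bar>f x\<bar> \<le> B)"

lemma bounded_measurable_mult:
  assumes "bounded_measurable f" "bounded_measurable g"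
  shows "bounded_measurable (\<lambda>x. f x * g x)"
proof -
  obtain B C where "\<forall>x\<in>usphere. \<bar>f x\<bar> \<le> B" "\<forall>x\<in>usphere. \<bar>g x\<bar> \<le> C"
    using assms by (auto simp: bounded_measurable_def)
  then have "\<forall>x\<in>usphere. \<bar>f x * g x\<bar> \<le> B * C"
    unfolding abs_mult by (meson abs_ge_zero mult_mono order_trans)
  then show ?thesis
    using assms unfolding bounded_measurable_def by auto
qed

lemma bounded_measurable_sum:
  assumes "\<And>i. i \<in> I \<Longrightarrow> bounded_measurable (f i)"
  shows "bounded_measurable (\<lambda>x. \<Sum>i\<in>I. c i * f i x)"
proof -
  obtain B where B: "\<And>i x. i \<in> I \<Longrightarrow> x \<in> usphere \<Longrightarrow> \<bar>f i x\<bar> \<le> B i"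
    using assms unfolding bounded_measurable_def by metis
  have "\<bar>\<Sum>i\<in>I. c i * f i x\<bar> \<le> (\<Sum>i\<in>I. \<bar>c i\<bar> * B i)" if "x \<in> usphere" for x
    using B[OF _ that] by (intro order_trans[OF sum_abs] sum_mono) (auto simp: abs_mult mult_left_mono)
  moreover have "(\<lambda>x. \<Sum>i\<in>I. c i * f i x) \<in> borel_measurable \<omega>"
    using assms by (intro borel_measurable_sum borel_measurable_times) (auto simp: bounded_measurable_def)
  ultimately show ?thesis unfolding bounded_measurable_def by blast
qed

lemma integrable_bounded_measurable: "bounded_measurable f \<Longrightarrow> integrable \<omega> f"
  unfolding bounded_measurable_def using integrable_bounded by blast

lemma bounded_measurable_harmonic:
  assumes "l \<in> {1..Z k}"
  shows "bounded_measurable (Y k l)"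
proof -
  obtain p where p: "Y k l = sphere_fun p" "real_polynomial_function p"
    "\<forall>c x. p (c *\<^sub>R x) = c ^ k * p x" "\<forall>x. laplacian p x = 0"
    using harmonic_polynomial[OF assms] .
  obtain B where "\<And>x. x \<in> usphere \<Longrightarrow> \<bar>p x\<bar> \<le> B" using polynomial_bounded[OF p(2)] by blast
  then have "\<forall>x\<in>usphere. \<bar>Y k l x\<bar> \<le> B" by (simp add: p(1) sphere_fun_def)
  moreover have "Y k l \<in> borel_measurable \<omega> \<longleftrightarrow> p \<in> borel_measurable \<omega>"
    by (intro measurable_cong) (simp add: p(1) sphere_fun_def)
  moreover have "p \<in> borel_measurable \<omega>" using integrable_polynomial[OF p(2)] by auto
  ultimately show ?thesis unfolding bounded_measurable_def by blast
qed

lemma harmonics_orthonormal: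
  assumes "l \<in> {1..Z k}" "l' \<in> {1..Z k'}"
  shows "(LINT x|\<omega>. Y k l x * Y k' l' x) = (if k = k' \<and> l = l' then 1 else 0)"
proof (cases "k = k'")
  case True
  then show ?thesis
    using basis assms unfolding orthonormal_harmonic_bases_def by auto
next
  case False
  obtain p where p: "Y k l = sphere_fun p" "real_polynomial_function p"
    "\<forall>c x. p (c *\<^sub>R x) = c ^ k * p x" "\<forall>x. laplacian p x = 0"
    using harmonic_polynomial[OF assms(1)] .
  obtain q where q: "Y k' l' = sphere_fun q" "real_polynomial_function q"
    "\<forall>c x. q (c *\<^sub>R x) = c ^ k' * q x" "\<forall>x. laplacian q x = 0"
    using harmonic_polynomial[OF assms(2)] .
  have "(LINT x|\<omega>. Y k l x * Y k' l' x) = (LINT x|\<omega>. p x * q x)"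
    by (intro Bochner_Integration.integral_cong) (simp_all add: p(1) q(1) sphere_fun_def)
  also have "\<dots> = 0"
    using homogeneous_harmonics_orthogonal[OF p(2) q(2) p(3)[rule_format] q(3)[rule_format]
      p(4)[rule_format] q(4)[rule_format] False dim] .
  finally show ?thesis using False by simp
qed

lemma kernel_sums:
  assumes "x \<in> usphere" "y \<in> usphere"
  shows "(\<lambda>k. \<phi>h k * (\<Sum>l=1..Z k. Y k l x * Y k l y)) sums \<phi> (x \<bullet> y)"
  using kernel assms by (simp add: spherical_basis_function_def)

lemma kernel_diagonal:
  assumes "x \<in> usphere"
  shows "(\<lambda>k. \<phi>h k * (\<Sum>l=1..Z k. (Y k l x)\<^sup>2)) sums \<phi> 1"
  using kernel_sums[OF assms assms] assms by (simp add: power2_eq_square norm_eq_1)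

text \<open>
  $|ay| = |a/\sqrt t|\cdot|\sqrt t\,y| \le (a^2/t + t y^2)/2$ with $t = \hat\phi_k$. Summed over
  $k$, the second part is $\phi(1)/2$ at every point of the sphere, so a series with finite native norm
  converges absolutely, with a bound that does not depend on the point.
\<close>

lemma abs_block_le:
  "\<bar>block a x k\<bar> \<le> (weight a k + \<phi>h k * (\<Sum>l=1..Z k. (Y k l x)\<^sup>2)) / 2"
proof -
  have 1: "\<bar>s * y\<bar> \<le> (inverse t * s\<^sup>2 + t * y\<^sup>2) / 2" if "t > 0" for s y t :: real
  proof -
    have "0 \<le> (\<bar>s\<bar> - t * \<bar>y\<bar>)\<^sup>2 / t" using that by simp
    also have "\<dots> = inverse t * s\<^sup>2 + t * y\<^sup>2 - 2 * \<bar>s * y\<bar>"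
      using that by (simp add: power2_eq_square field_simps abs_mult)
    finally show ?thesis by simp
  qed
  have "\<bar>block a x k\<bar> \<le> (\<Sum>l=1..Z k. \<bar>a k l * Y k l x\<bar>)"
    unfolding block_def by (rule sum_abs)
  also have "\<dots> \<le> (\<Sum>l=1..Z k. (inverse (\<phi>h k) * (a k l)\<^sup>2 + \<phi>h k * (Y k l x)\<^sup>2) / 2)"
    by (intro sum_mono 1) simp
  also have "\<dots> = (weight a k + \<phi>h k * (\<Sum>l=1..Z k. (Y k l x)\<^sup>2)) / 2"
    by (simp add: weight_def sum.distrib sum_distrib_left flip: sum_divide_distrib)
  finally show ?thesis .
qed

lemma
  assumes a: "summable (weight a)" and x: "x \<in> usphere"
  shows summable_block: "summable (block a x)"
    and block_partial_sum_le: "\<bar>\<Sum>k<K. block a x k\<bar> \<le> (suminf (weight a) + \<phi> 1) / 2"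
    and block_sum_le: "(block a x) sums s \<Longrightarrow> \<bar>s\<bar> \<le> (suminf (weight a) + \<phi> 1) / 2"
proof -
  let ?g = "\<lambda>k. (weight a k + \<phi>h k * (\<Sum>l=1..Z k. (Y k l x)\<^sup>2)) / 2"
  have g: "?g sums ((suminf (weight a) + \<phi> 1) / 2)"
    by (intro sums_divide sums_add summable_sums a kernel_diagonal x)
  have g0: "0 \<le> ?g k" for k
    using abs_block_le[of a x k] by (meson abs_ge_zero order_trans)
  show "summable (block a x)"
    by (rule summable_comparison_test'[OF sums_summable[OF g], of 0])
      (simp only: real_norm_def abs_block_le)
  have *: "\<bar>\<Sum>k<K. block a x k\<bar> \<le> (suminf (weight a) + \<phi> 1) / 2" for K
  proof -
    have "\<bar>\<Sum>k<K. block a x k\<bar> \<le> (\<Sum>k<K. ?g k)"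
      by (intro order_trans[OF sum_abs] sum_mono abs_block_le)
    also have "\<dots> \<le> suminf ?g"
      using g0 by (intro sum_le_suminf sums_summable[OF g]) auto
    finally show ?thesis using sums_unique[OF g] by simp
  qed
  then show "\<bar>\<Sum>k<K. block a x k\<bar> \<le> (suminf (weight a) + \<phi> 1) / 2" .
  show "\<bar>s\<bar> \<le> (suminf (weight a) + \<phi> 1) / 2" if "(block a x) sums s"
  proof (rule LIMSEQ_le_const2)
    show "(\<lambda>K. \<bar>\<Sum>k<K. block a x k\<bar>) \<longlonglongrightarrow> \<bar>s\<bar>"
      using that unfolding sums_def by (rule tendsto_rabs)
  qed (use * in blast)
qed

lemma bounded_measurable_block: "bounded_measurable (\<lambda>x. block a x k)"
  unfolding block_def by (intro bounded_measurable_sum bounded_measurable_harmonic)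

lemma bounded_measurable_blocks: "bounded_measurable (\<lambda>x. \<Sum>k<K. block a x k)"
  using bounded_measurable_sum[of "{..<K}" "\<lambda>k x. block a x k" "\<lambda>_. 1"] bounded_measurable_block
  by simp

lemma bounded_measurable_series:
  assumes a: "summable (weight a)" and F: "\<And>x. x \<in> usphere \<Longrightarrow> (block a x) sums F x"
  shows "bounded_measurable F"
proof -
  have "F \<in> borel_measurable \<omega>"
  proof (rule borel_measurable_LIMSEQ_real)
    show "(\<lambda>K. \<Sum>k<K. block a x k) \<longlonglongrightarrow> F x" if "x \<in> space \<omega>" for x
      using F that unfolding sums_def by simp
    show "(\<lambda>x. \<Sum>k<K. block a x k) \<in> borel_measurable \<omega>" for K
      using bounded_measurable_blocks unfolding bounded_measurable_def by blast
  qed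
  then show ?thesis
    unfolding bounded_measurable_def using block_sum_le[OF a _ F] by blast
qed

text \<open>
  Termwise integration, by dominated convergence: the partial sums are bounded by the constant of
  \<open>block_partial_sum_le\<close>. Taking \<open>g\<close> to be a harmonic recovers the coefficients; taking it to be the
  sum itself gives Parseval's identity.
\<close>

lemma series_integral:
  assumes a: "summable (weight a)" and F: "\<And>x. x \<in> usphere \<Longrightarrow> (block a x) sums F x"
    and g: "bounded_measurable g"
  shows "(\<lambda>k. \<Sum>l=1..Z k. a k l * (LINT x|\<omega>. Y k l x * g x)) sums (LINT x|\<omega>. F x * g x)"
proof -
  obtain B where B: "\<And>x. x \<in> usphere \<Longrightarrow> \<bar>g x\<bar> \<le> B"
    using g unfolding bounded_measurable_def by blast
  have Yg: "integrable \<omega> (\<lambda>x. Y k l x * g x)" if "l \<in> {1..Z k}" for k l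
    using that g by (intro integrable_bounded_measurable bounded_measurable_mult bounded_measurable_harmonic)
  have partial: "(LINT x|\<omega>. (\<Sum>k<K. block a x k) * g x) =
      (\<Sum>k<K. \<Sum>l=1..Z k. a k l * (LINT x|\<omega>. Y k l x * g x))" for K
  proof -
    have "(LINT x|\<omega>. (\<Sum>k<K. block a x k) * g x) =
       (LINT x|\<omega>. (\<Sum>k<K. \<Sum>l=1..Z k. a k l * (Y k l x * g x)))"
      by (simp add: block_def sum_distrib_right mult.assoc)
    also have "\<dots> = (\<Sum>k<K. LINT x|\<omega>. (\<Sum>l=1..Z k. a k l * (Y k l x * g x)))"
      using Yg by (intro Bochner_Integration.integral_sum Bochner_Integration.integrable_sum
        integrable_mult_right) auto
    also have "\<dots> = (\<Sum>k<K. \<Sum>l=1..Z k. a k l * (LINT x|\<omega>. Y k l x * g x))"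
    proof (rule sum.cong[OF refl])
      fix k
      have "(LINT x|\<omega>. (\<Sum>l=1..Z k. a k l * (Y k l x * g x))) =
          (\<Sum>l=1..Z k. LINT x|\<omega>. a k l * (Y k l x * g x))"
        using Yg by (intro Bochner_Integration.integral_sum integrable_mult_right) auto
      then show "(LINT x|\<omega>. (\<Sum>l=1..Z k. a k l * (Y k l x * g x))) =
          (\<Sum>l=1..Z k. a k l * (LINT x|\<omega>. Y k l x * g x))" by simp
    qed
    finally show ?thesis .
  qed
  have "(\<lambda>K. LINT x|\<omega>. (\<Sum>k<K. block a x k) * g x) \<longlonglongrightarrow> (LINT x|\<omega>. F x * g x)"
  proof (rule integral_dominated_convergence[where w = "\<lambda>_. (suminf (weight a) + \<phi> 1) / 2 * B"])
    show "(\<lambda>x. F x * g x) \<in> borel_measurable \<omega>"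
      using bounded_measurable_mult[OF bounded_measurable_series[OF a F] g]
      unfolding bounded_measurable_def by blast
    show "(\<lambda>x. (\<Sum>k<K. block a x k) * g x) \<in> borel_measurable \<omega>" for K
      using bounded_measurable_mult[OF bounded_measurable_blocks g]
      unfolding bounded_measurable_def by blast
    show "AE x in \<omega>. (\<lambda>K. (\<Sum>k<K. block a x k) * g x) \<longlonglongrightarrow> F x * g x"
      using F by (intro AE_I2 tendsto_mult_right) (simp add: sums_def)
    show "AE x in \<omega>. norm ((\<Sum>k<K. block a x k) * g x) \<le> (suminf (weight a) + \<phi> 1) / 2 * B" for K
    proof (rule AE_I2)
      fix x assume "x \<in> space \<omega>"
      then have x: "x \<in> usphere" by simp
      have "0 \<le> (suminf (weight a) + \<phi> 1) / 2"
        using block_partial_sum_le[OF a x, of 0] by simp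
      then show "norm ((\<Sum>k<K. block a x k) * g x) \<le> (suminf (weight a) + \<phi> 1) / 2 * B"
        using block_partial_sum_le[OF a x, of K] B[OF x] by (simp only: real_norm_def abs_mult mult_mono)
    qed
  qed auto
  then show ?thesis by (simp add: sums_def partial)
qed

lemma coeff_series:
  assumes a: "summable (weight a)" and F: "\<And>x. x \<in> usphere \<Longrightarrow> (block a x) sums F x"
    and l: "l \<in> {1..Z k}"
  shows "coeff F k l = a k l"
proof -
  have "(\<lambda>k'. \<Sum>l'=1..Z k'. a k' l' * (LINT x|\<omega>. Y k' l' x * Y k l x)) sums (LINT x|\<omega>. F x * Y k l x)"
    by (intro series_integral[OF a F] bounded_measurable_harmonic l)
  moreover have "(\<Sum>l'=1..Z k'. a k' l' * (LINT x|\<omega>. Y k' l' x * Y k l x)) = (if k' = k then a k l else 0)" for k'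
  proof -
    have "(\<Sum>l'=1..Z k'. a k' l' * (LINT x|\<omega>. Y k' l' x * Y k l x)) =
        (\<Sum>l'=1..Z k'. if l' = l then (if k' = k then a k l else 0) else 0)"
    proof (rule sum.cong[OF refl])
      fix l' assume "l' \<in> {1..Z k'}"
      from harmonics_orthonormal[OF this l]
      show "a k' l' * (LINT x|\<omega>. Y k' l' x * Y k l x) =
          (if l' = l then (if k' = k then a k l else 0) else 0)" by simp
    qed
    then show ?thesis using l by auto
  qed
  ultimately have "(\<lambda>k'. if k' = k then a k l else 0) sums coeff F k l"
    by (simp add: fcoeff_def)
  then show ?thesis using sums_single[of k "\<lambda>_. a k l"] by (metis (no_types, lifting) sums_unique2)
qed

lemma weight_cong: "(\<And>l. l \<in> {1..Z k} \<Longrightarrow> a k l = b k l) \<Longrightarrow> weight a k = weight b k"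
  by (simp add: weight_def)

lemma block_cong: "(\<And>l. l \<in> {1..Z k} \<Longrightarrow> a k l = b k l) \<Longrightarrow> block a x k = block b x k"
  by (simp add: block_def)

lemma native_memD:
  assumes "f \<in> N"
  shows "summable (weight (coeff f))" "x \<in> usphere \<Longrightarrow> (block (coeff f) x) sums f x"
    "x \<notin> usphere \<Longrightarrow> f x = 0"
  using assms by (auto simp: native_fun_def native_L2_def L2_space_def weight_def[abs_def] block_def[abs_def])

lemma bounded_measurable_native: "f \<in> N \<Longrightarrow> bounded_measurable f"
  by (rule bounded_measurable_series[OF native_memD(1,2)])

text \<open>
  Membership in the native space is always established by exhibiting coefficients. Termwise integration
  shows that the Fourier coefficients of the pointwise sum are the given ones, and the uniform bound on
  the partial sums turns pointwise convergence into convergence in $L^2$.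
\<close>

lemma native_memI:
  assumes a: "summable (weight a)" and F: "\<And>x. x \<in> usphere \<Longrightarrow> (block a x) sums F x"
    and 0: "\<And>x. x \<notin> usphere \<Longrightarrow> F x = 0"
  shows "F \<in> N"
proof -
  let ?C = "(suminf (weight a) + \<phi> 1) / 2"
  note co = coeff_series[OF a F]
  have bm: "bounded_measurable F" by (rule bounded_measurable_series[OF a F])
  have w: "weight (coeff F) = weight a" using co by (intro ext weight_cong) auto
  have b: "block (coeff F) x = block a x" for x using co by (intro ext block_cong) auto
  have "F \<in> L2_space \<omega>"
    using 0 bm integrable_bounded_measurable[OF bounded_measurable_mult[OF bm bm]]
    by (simp add: L2_space_def bounded_measurable_def power2_eq_square)
  moreover have "(\<lambda>K. L2norm \<omega> (\<lambda>x. F x - (\<Sum>k<K. block (coeff F) x k))) \<longlonglongrightarrow> 0"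
  proof -
    have bd: "bounded_measurable (\<lambda>x. F x - (\<Sum>k<K. block a x k))" for K
      using bounded_measurable_sum[of UNIV "\<lambda>i. if i then F else (\<lambda>x. \<Sum>k<K. block a x k)"
         "\<lambda>i. if i then 1 else -1"] bm bounded_measurable_blocks
      by (simp add: UNIV_bool)
    have "(\<lambda>K. LINT x|\<omega>. (F x - (\<Sum>k<K. block a x k))\<^sup>2) \<longlonglongrightarrow> (LINT x|\<omega>. 0)"
    proof (rule integral_dominated_convergence[where w = "\<lambda>_. (2 * ?C)\<^sup>2"])
      show "(\<lambda>x. (F x - (\<Sum>k<K. block a x k))\<^sup>2) \<in> borel_measurable \<omega>" for K
        using bounded_measurable_mult[OF bd bd] by (simp add: bounded_measurable_def power2_eq_square)
      show "AE x in \<omega>. (\<lambda>K. (F x - (\<Sum>k<K. block a x k))\<^sup>2) \<longlonglongrightarrow> 0"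
      proof (rule AE_I2)
        fix x assume "x \<in> space \<omega>"
        then have "(\<lambda>K. (F x - (\<Sum>k<K. block a x k))\<^sup>2) \<longlonglongrightarrow> (F x - F x)\<^sup>2"
          using F by (intro tendsto_intros) (simp add: sums_def)
        then show "(\<lambda>K. (F x - (\<Sum>k<K. block a x k))\<^sup>2) \<longlonglongrightarrow> 0" by simp
      qed
      show "AE x in \<omega>. norm ((F x - (\<Sum>k<K. block a x k))\<^sup>2) \<le> (2 * ?C)\<^sup>2" for K
      proof (rule AE_I2)
        fix x assume "x \<in> space \<omega>"
        then have x: "x \<in> usphere" by simp
        have "\<bar>F x - (\<Sum>k<K. block a x k)\<bar> \<le> 2 * ?C"
          using block_partial_sum_le[OF a x, of K] block_sum_le[OF a x F[OF x]] by linarith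
        then have "\<bar>F x - (\<Sum>k<K. block a x k)\<bar>\<^sup>2 \<le> (2 * ?C)\<^sup>2"
          by (intro power_mono) auto
        then show "norm ((F x - (\<Sum>k<K. block a x k))\<^sup>2) \<le> (2 * ?C)\<^sup>2" by simp
      qed
    qed auto
    then have "(\<lambda>K. sqrt (LINT x|\<omega>. (F x - (\<Sum>k<K. block a x k))\<^sup>2)) \<longlonglongrightarrow> sqrt 0"
      by (intro tendsto_real_sqrt) simp
    then show ?thesis by (simp add: L2norm_def b)
  qed
  moreover have "summable (weight (coeff F))" using a w by simp
  moreover have "\<forall>x\<in>usphere. (block (coeff F) x) sums F x" using F b by simp
  ultimately show ?thesis
    by (simp add: native_fun_def native_L2_def weight_def[abs_def] block_def[abs_def])
qed

lemma native_exists: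
  assumes a: "summable (weight a)"
  obtains F where "F \<in> N" "\<And>k l. l \<in> {1..Z k} \<Longrightarrow> coeff F k l = a k l"
proof -
  define F where "F x = (if x \<in> usphere then suminf (block a x) else 0)" for x
  have F: "(block a x) sums F x" if "x \<in> usphere" for x
    using summable_sums[OF summable_block[OF a that]] that by (simp add: F_def)
  show ?thesis
    by (rule that[OF native_memI[OF a F] coeff_series[OF a F]]) (auto simp: F_def)
qed

lemma summable_weight_lincomb:
  assumes "summable (weight a)" "summable (weight b)"
  shows "summable (weight (\<lambda>k l. s * a k l + t * b k l))"
proof (rule summable_comparison_test'[of "\<lambda>k. 2 * s\<^sup>2 * weight a k + 2 * t\<^sup>2 * weight b k" 0])
  show "summable (\<lambda>k. 2 * s\<^sup>2 * weight a k + 2 * t\<^sup>2 * weight b k)"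
    by (intro summable_add summable_mult assms)
  have "(s * a k l + t * b k l)\<^sup>2 \<le> 2 * s\<^sup>2 * (a k l)\<^sup>2 + 2 * t\<^sup>2 * (b k l)\<^sup>2" for k l
    using zero_le_power2[of "s * a k l - t * b k l"]
    by (simp add: power2_sum power2_diff power_mult_distrib)
  then have "weight (\<lambda>k l. s * a k l + t * b k l) k \<le>
      inverse (\<phi>h k) * (\<Sum>l=1..Z k. 2 * s\<^sup>2 * (a k l)\<^sup>2 + 2 * t\<^sup>2 * (b k l)\<^sup>2)" for k
    unfolding weight_def by (intro mult_left_mono sum_mono) (auto simp: less_imp_le)
  also have "inverse (\<phi>h k) * (\<Sum>l=1..Z k. 2 * s\<^sup>2 * (a k l)\<^sup>2 + 2 * t\<^sup>2 * (b k l)\<^sup>2) =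
      2 * s\<^sup>2 * weight a k + 2 * t\<^sup>2 * weight b k" for k
    by (simp add: weight_def sum.distrib ring_distribs flip: sum_distrib_left)
  finally show "norm (weight (\<lambda>k l. s * a k l + t * b k l) k) \<le> 2 * s\<^sup>2 * weight a k + 2 * t\<^sup>2 * weight b k" for k
    by simp
qed

lemma
  assumes f: "f \<in> N" and g: "g \<in> N"
  shows native_lincomb: "lincomb s f t g \<in> N"
    and coeff_lincomb: "l \<in> {1..Z k} \<Longrightarrow> coeff (lincomb s f t g) k l = s * coeff f k l + t * coeff g k l"
proof -
  let ?a = "\<lambda>k l. s * coeff f k l + t * coeff g k l"
  have a: "summable (weight ?a)" by (intro summable_weight_lincomb native_memD f g)
  have "(\<lambda>k. s * block (coeff f) x k + t * block (coeff g) x k) sums lincomb s f t g x" if "x \<in> usphere" for x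
    unfolding lincomb_def by (intro sums_add sums_mult native_memD f g that)
  moreover have "s * block (coeff f) x k + t * block (coeff g) x k = block ?a x k" for x k
    by (simp add: block_def ring_distribs sum.distrib sum_distrib_left mult_ac)
  ultimately have F: "block ?a x sums lincomb s f t g x" if "x \<in> usphere" for x
    using that by simp
  show "lincomb s f t g \<in> N"
    by (intro native_memI[OF a F])
      (simp_all add: lincomb_def native_memD(3)[OF f] native_memD(3)[OF g] del: mem_sphere)
  show "l \<in> {1..Z k} \<Longrightarrow> coeff (lincomb s f t g) k l = s * coeff f k l + t * coeff g k l"
    using coeff_series[OF a F] .
qed

lemma nip_sums:
  assumes f: "f \<in> N" and g: "g \<in> N"
  shows "(\<lambda>k. inverse (\<phi>h k) * (\<Sum>l=1..Z k. coeff f k l * coeff g k l)) sums nip f g"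
proof -
  have "summable (\<lambda>k. inverse (\<phi>h k) * (\<Sum>l=1..Z k. coeff f k l * coeff g k l))"
  proof (rule summable_comparison_test'[of "\<lambda>k. weight (coeff f) k + weight (coeff g) k" 0])
    show "summable (\<lambda>k. weight (coeff f) k + weight (coeff g) k)"
      by (intro summable_add native_memD f g)
    fix k
    have 1: "\<bar>s * t\<bar> \<le> s\<^sup>2 + t\<^sup>2" for s t :: real
    proof -
      have "2 * \<bar>s * t\<bar> \<le> s\<^sup>2 + t\<^sup>2"
        using zero_le_power2[of "\<bar>s\<bar> - \<bar>t\<bar>"] by (simp add: power2_diff abs_mult)
      then show ?thesis using abs_ge_zero[of "s * t"] by linarith
    qed
    have "\<bar>inverse (\<phi>h k) * (\<Sum>l=1..Z k. coeff f k l * coeff g k l)\<bar> \<le>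
        inverse (\<phi>h k) * (\<Sum>l=1..Z k. (coeff f k l)\<^sup>2 + (coeff g k l)\<^sup>2)"
      unfolding abs_mult using \<phi>h_pos[of k]
      by (intro mult_mono order_trans[OF sum_abs] sum_mono 1) (auto simp: less_imp_le)
    then show "norm (inverse (\<phi>h k) * (\<Sum>l=1..Z k. coeff f k l * coeff g k l)) \<le>
        weight (coeff f) k + weight (coeff g) k"
      by (simp add: weight_def sum.distrib ring_distribs)
  qed
  then show ?thesis unfolding native_inner_def by (rule summable_sums)
qed

lemma weight_sums: "f \<in> N \<Longrightarrow> weight (coeff f) sums nip f f"
  using nip_sums[of f f] by (simp add: weight_def[abs_def] power2_eq_square)

lemma coeff_square_le:
  assumes f: "f \<in> N" and l: "l \<in> {1..Z k}"
  shows "(coeff f k l)\<^sup>2 \<le> \<phi>h k * nip f f"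
proof -
  have "(coeff f k l)\<^sup>2 \<le> (\<Sum>l=1..Z k. (coeff f k l)\<^sup>2)"
    using l by (intro member_le_sum) auto
  also have "\<dots> = \<phi>h k * weight (coeff f) k" by (simp add: weight_def)
  also have "\<dots> \<le> \<phi>h k * nip f f"
  proof (rule mult_left_mono)
    have "sum (weight (coeff f)) {k} \<le> suminf (weight (coeff f))"
      by (intro sum_le_suminf sums_summable[OF weight_sums[OF f]]) auto
    then show "weight (coeff f) k \<le> nip f f" using sums_unique[OF weight_sums[OF f]] by simp
  qed (simp add: less_imp_le)
  finally show ?thesis .
qed

text \<open>
  Each coefficient of a Cauchy sequence converges, since it is controlled by the norm. The limits have
  finite native norm, because the partial sums of
  $\sum_k \hat\phi_k^{-1}\sum_\ell(\cdot)^2$ pass to the limit, and they are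
  therefore the coefficients of an element of the space.
\<close>

lemma native_complete:
  assumes u: "\<And>n :: nat. u n \<in> N"
    and Cauchy: "\<And>e. e > 0 \<Longrightarrow> \<exists>M. \<forall>m\<ge>M. \<forall>n\<ge>M.
          sqrt (nip (lincomb 1 (u m) (-1) (u n)) (lincomb 1 (u m) (-1) (u n))) < e"
  shows "\<exists>f\<in>N. (\<lambda>n. sqrt (nip (lincomb 1 (u n) (-1) f) (lincomb 1 (u n) (-1) f))) \<longlonglongrightarrow> 0"
proof -
  define D where "D m n = lincomb 1 (u m) (-1) (u n)" for m n
  have D: "D m n \<in> N" and co: "l \<in> {1..Z k} \<Longrightarrow> coeff (D m n) k l = coeff (u m) k l - coeff (u n) k l" for m n k l
    using native_lincomb[OF u u] coeff_lincomb[OF u u] by (simp_all add: D_def)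
  have small: "\<exists>M. \<forall>m\<ge>M. \<forall>n\<ge>M. nip (D m n) (D m n) < e" if "e > 0" for e
    using Cauchy[of "sqrt e"] that by (simp add: D_def)
  have "\<exists>c. (\<lambda>n. coeff (u n) k l) \<longlonglongrightarrow> c" if l: "l \<in> {1..Z k}" for k l
  proof -
    have "Cauchy (\<lambda>n. coeff (u n) k l)"
    proof (rule CauchyI)
      fix e :: real assume "e > 0"
      then have "e\<^sup>2 / \<phi>h k > 0" using \<phi>h_pos by simp
      then obtain M where M: "\<forall>m\<ge>M. \<forall>n\<ge>M. nip (D m n) (D m n) < e\<^sup>2 / \<phi>h k"
        using small by blast
      have "norm (coeff (u m) k l - coeff (u n) k l) < e" if "m \<ge> M" "n \<ge> M" for m n
      proof -
        have "(coeff (u m) k l - coeff (u n) k l)\<^sup>2 \<le> \<phi>h k * nip (D m n) (D m n)"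
          using coeff_square_le[OF D l] co[OF l] by metis
        also have "\<dots> < \<phi>h k * (e\<^sup>2 / \<phi>h k)"
          using M that by (intro mult_strict_left_mono) auto
        also have "\<dots> = e\<^sup>2" using \<phi>h_pos[of k] by simp
        finally have "\<bar>coeff (u m) k l - coeff (u n) k l\<bar>\<^sup>2 < e\<^sup>2" by simp
        then show ?thesis using \<open>e > 0\<close> by (simp add: power2_less_imp_less)
      qed
      then show "\<exists>M. \<forall>m\<ge>M. \<forall>n\<ge>M. norm (coeff (u m) k l - coeff (u n) k l) < e" by blast
    qed
    then show ?thesis using Cauchy_convergent convergent_def by blast
  qed
  then obtain a where a: "\<And>k l. l \<in> {1..Z k} \<Longrightarrow> (\<lambda>n. coeff (u n) k l) \<longlonglongrightarrow> a k l" by metis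
  let ?d = "\<lambda>m k l. coeff (u m) k l - a k l"
  have tail: "\<exists>M. \<forall>m\<ge>M. summable (weight (?d m)) \<and> suminf (weight (?d m)) \<le> e" if e: "e > 0" for e
  proof -
    obtain M where M: "\<forall>m\<ge>M. \<forall>n\<ge>M. nip (D m n) (D m n) < e" using small[OF e] by blast
    have partial: "(\<Sum>k<K. weight (?d m) k) \<le> e" if "m \<ge> M" for m K
    proof (rule LIMSEQ_le_const2)
      show "(\<lambda>n. \<Sum>k<K. weight (\<lambda>k l. coeff (u m) k l - coeff (u n) k l) k) \<longlonglongrightarrow> (\<Sum>k<K. weight (?d m) k)"
        unfolding weight_def by (intro tendsto_intros a) auto
      have "(\<Sum>k<K. weight (\<lambda>k l. coeff (u m) k l - coeff (u n) k l) k) \<le> e" if "n \<ge> M" for n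
      proof -
        have "(\<Sum>k<K. weight (\<lambda>k l. coeff (u m) k l - coeff (u n) k l) k) = (\<Sum>k<K. weight (coeff (D m n)) k)"
          by (intro sum.cong refl weight_cong) (simp add: co)
        also have "\<dots> \<le> suminf (weight (coeff (D m n)))"
          by (intro sum_le_suminf sums_summable[OF weight_sums[OF D]]) auto
        also have "\<dots> = nip (D m n) (D m n)" using sums_unique[OF weight_sums[OF D]] by simp
        finally show ?thesis using M \<open>m \<ge> M\<close> that by fastforce
      qed
      then show "\<exists>n0. \<forall>n\<ge>n0. (\<Sum>k<K. weight (\<lambda>k l. coeff (u m) k l - coeff (u n) k l) k) \<le> e" by blast
    qed
    have "summable (weight (?d m)) \<and> suminf (weight (?d m)) \<le> e" if "m \<ge> M" for m
    proof
      show "summable (weight (?d m))"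
        by (intro summableI_nonneg_bounded[of _ e] partial[OF that] weight_nonneg)
      then show "suminf (weight (?d m)) \<le> e" by (intro suminf_le_const partial[OF that])
    qed
    then show ?thesis by blast
  qed
  obtain m where m: "summable (weight (?d m))" using tail[of 1] by auto
  have "summable (weight (\<lambda>k l. 1 * coeff (u m) k l + (-1) * ?d m k l))"
    by (intro summable_weight_lincomb native_memD u m)
  then have "summable (weight a)" by simp
  then obtain F where F: "F \<in> N" "\<And>k l. l \<in> {1..Z k} \<Longrightarrow> coeff F k l = a k l"
    using native_exists by blast
  have eq: "nip (lincomb 1 (u n) (-1) F) (lincomb 1 (u n) (-1) F) = suminf (weight (?d n))" for n
  proof -
    have "weight (coeff (lincomb 1 (u n) (-1) F)) = weight (?d n)"
      by (intro ext weight_cong) (simp add: coeff_lincomb u F)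
    then show ?thesis using sums_unique[OF weight_sums[OF native_lincomb[OF u[of n] F(1), of 1 "-1"]]] by simp
  qed
  have "(\<lambda>n. suminf (weight (?d n))) \<longlonglongrightarrow> 0"
  proof (rule LIMSEQ_I)
    fix e :: real assume "e > 0"
    then obtain M where M: "\<forall>m\<ge>M. summable (weight (?d m)) \<and> suminf (weight (?d m)) \<le> e / 2"
      using tail[of "e / 2"] by auto
    have "norm (suminf (weight (?d n)) - 0) < e" if "n \<ge> M" for n
    proof -
      have "0 \<le> suminf (weight (?d n))" "suminf (weight (?d n)) \<le> e / 2"
        using M that by (auto intro!: suminf_nonneg)
      then show ?thesis using \<open>e > 0\<close> by simp
    qed
    then show "\<exists>M. \<forall>n\<ge>M. norm (suminf (weight (?d n)) - 0) < e" by blast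
  qed
  from tendsto_real_sqrt[OF this] show ?thesis
    by (intro bexI[OF _ F(1)]) (simp add: eq)
qed

sublocale native: function_hilbert_space N nip
proof
  show "(\<lambda>_. 0) \<in> N"
    by (rule native_memI[of "\<lambda>_ _. 0"]) (simp_all add: weight_def[abs_def] block_def[abs_def])
  show "lincomb a f b g \<in> N" if "f \<in> N" "g \<in> N" for a f b g using native_lincomb that .
  show "nip f g = nip g f" for f g by (simp add: native_inner_def mult.commute)
  show "nip (lincomb a f b g) h = a * nip f h + b * nip g h" if "f \<in> N" "g \<in> N" "h \<in> N" for a f b g h
  proof -
    let ?t = "\<lambda>f k. inverse (\<phi>h k) * (\<Sum>l=1..Z k. coeff f k l * coeff h k l)"
    have "?t (lincomb a f b g) k = a * ?t f k + b * ?t g k" for k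
    proof -
      have "(\<Sum>l=1..Z k. coeff (lincomb a f b g) k l * coeff h k l) =
          (\<Sum>l=1..Z k. (a * coeff f k l + b * coeff g k l) * coeff h k l)"
        by (intro sum.cong refl) (simp add: coeff_lincomb that)
      then show ?thesis
        by (simp add: ring_distribs sum.distrib sum_distrib_left mult_ac)
    qed
    moreover have "(\<lambda>k. a * ?t f k + b * ?t g k) sums (a * nip f h + b * nip g h)"
      by (intro sums_add sums_mult nip_sums that)
    ultimately have "?t (lincomb a f b g) sums (a * nip f h + b * nip g h)" by simp
    then show ?thesis using nip_sums[OF native_lincomb[OF that(1,2)] that(3)] sums_unique2 by blast
  qed
  show "0 \<le> nip f f" if "f \<in> N" for f
    using sums_le[OF _ sums_zero weight_sums[OF that]] by simp
  show "f = (\<lambda>_. 0)" if "f \<in> N" "nip f f = 0" for f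
  proof
    fix x
    have "coeff f k l = 0" if "l \<in> {1..Z k}" for k l
      using coeff_square_le[OF \<open>f \<in> N\<close> that] \<open>nip f f = 0\<close> by simp
    then have "block (coeff f) x k = 0" for k by (simp add: block_def)
    then have "block (coeff f) x = (\<lambda>_. 0)" by (rule ext)
    then show "f x = 0"
      using native_memD(2,3)[OF that(1), of x] sums_unique2[OF sums_zero] by metis
  qed
qed (rule native_complete)

end

section \<open>The kernel, the integral operator and its discretization\<close>

context spherical_kernel
begin

lemma native_eqI:
  assumes f: "f \<in> N" and g: "g \<in> N"
    and eq: "\<And>k l. l \<in> {1..Z k} \<Longrightarrow> coeff f k l = coeff g k l"
  shows "f = g"
proof
  fix x
  have "block (coeff f) x = block (coeff g) x" by (intro ext block_cong eq)
  then show "f x = g x"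
    using native_memD(2,3)[OF f, of x] native_memD(2,3)[OF g, of x] sums_unique2 by metis
qed

definition kernel_at :: "real ^ 'n \<Rightarrow> real ^ 'n \<Rightarrow> real" where
  "kernel_at x = sphere_fun (\<lambda>y. \<phi> (x \<bullet> y))"

lemma
  assumes x: "x \<in> usphere"
  shows summable_weight_kernel: "summable (weight (\<lambda>k l. \<phi>h k * Y k l x))"
    and kernel_at_sums: "y \<in> usphere \<Longrightarrow> block (\<lambda>k l. \<phi>h k * Y k l x) y sums kernel_at x y"
proof -
  have "weight (\<lambda>k l. \<phi>h k * Y k l x) k = \<phi>h k * (\<Sum>l=1..Z k. (Y k l x)\<^sup>2)" for k
    by (simp add: weight_def power_mult_distrib power2_eq_square[of "\<phi>h k"] mult.assoc
      flip: sum_distrib_left)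
  then show "summable (weight (\<lambda>k l. \<phi>h k * Y k l x))"
    using sums_summable[OF kernel_diagonal[OF x]] by presburger
  have "block (\<lambda>k l. \<phi>h k * Y k l x) y k = \<phi>h k * (\<Sum>l=1..Z k. Y k l x * Y k l y)" for y k
    by (simp add: block_def sum_distrib_left mult.assoc)
  then have "block (\<lambda>k l. \<phi>h k * Y k l x) y = (\<lambda>k. \<phi>h k * (\<Sum>l=1..Z k. Y k l x * Y k l y))" for y
    by (rule ext)
  then show "y \<in> usphere \<Longrightarrow> block (\<lambda>k l. \<phi>h k * Y k l x) y sums kernel_at x y"
    using kernel_sums[OF x, of y] by (simp add: kernel_at_def sphere_fun_def)
qed

lemma kernel_at_mem: "x \<in> usphere \<Longrightarrow> kernel_at x \<in> N"
  by (rule native_memI[OF summable_weight_kernel kernel_at_sums])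
    (simp_all add: kernel_at_def sphere_fun_def)

text \<open>
  The coefficient of the kernel at $x$ for $Y_{k,\ell}$ is $\hat\phi_k Y_{k,\ell}(x)$, and the factor
  $\hat\phi_k^{-1}$ of the inner product cancels $\hat\phi_k$, leaving the expansion of $f$ at $x$.
\<close>

lemma reproducing:
  assumes f: "f \<in> N" and x: "x \<in> usphere"
  shows "nip (kernel_at x) f = f x"
proof -
  have "inverse (\<phi>h k) * (\<Sum>l=1..Z k. coeff (kernel_at x) k l * coeff f k l) = block (coeff f) x k" for k
  proof -
    have "(\<Sum>l=1..Z k. coeff (kernel_at x) k l * coeff f k l) = (\<Sum>l=1..Z k. \<phi>h k * (coeff f k l * Y k l x))"
      using coeff_series[OF summable_weight_kernel[OF x] kernel_at_sums[OF x]]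
      by (intro sum.cong refl) simp
    then show ?thesis by (simp add: block_def flip: sum_distrib_left)
  qed
  then have "block (coeff f) x sums nip (kernel_at x) f"
    using nip_sums[OF kernel_at_mem[OF x] f] by simp
  then show ?thesis using native_memD(2)[OF f x] sums_unique2 by blast
qed

lemma native_pointwise_le:
  assumes f: "f \<in> N" and x: "x \<in> usphere"
  shows "(f x)\<^sup>2 \<le> \<phi> 1 * nip f f"
proof -
  have "\<bar>f x\<bar> \<le> native.nrm (kernel_at x) * native.nrm f"
    using native.Cauchy_Schwarz[OF kernel_at_mem[OF x] f] reproducing[OF f x] by simp
  then have "\<bar>f x\<bar>\<^sup>2 \<le> (native.nrm (kernel_at x) * native.nrm f)\<^sup>2"
    by (intro power_mono) auto
  also have "\<dots> = nip (kernel_at x) (kernel_at x) * nip f f"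
    unfolding power_mult_distrib
    by (simp add: power2_eq_square native.nrm_square[OF kernel_at_mem[OF x]] native.nrm_square[OF f])
  also have "nip (kernel_at x) (kernel_at x) = \<phi> 1"
    using reproducing[OF kernel_at_mem[OF x] x] x by (simp add: kernel_at_def sphere_fun_def norm_eq_1)
  finally show ?thesis by simp
qed

text \<open>
  Where $Z(d,k) \ge 1$, the number $\hat\phi_k$ is at most $\hat\phi_k Z(d,k)$, the term of a convergent
  series. Degrees with $Z(d,k) = 0$ contribute empty sums.
\<close>

lemma spectrum_bounded:
  obtains C where "0 \<le> C" "\<forall>k. Z k \<noteq> 0 \<longrightarrow> \<phi>h k \<le> C"
    "\<forall>a k. (\<Sum>l=1..Z k. (a k l)\<^sup>2) \<le> C * weight a k"
proof -
  have "summable (\<lambda>k. \<phi>h k * real (Z k))"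
    using kernel by (simp add: spherical_basis_function_def)
  then have "Bseq (\<lambda>k. \<phi>h k * real (Z k))"
    using summable_LIMSEQ_zero convergentI convergent_imp_Bseq by blast
  then obtain C where C: "C > 0" "\<And>k. norm (\<phi>h k * real (Z k)) \<le> C" by (auto elim: BseqE)
  have le: "\<phi>h k \<le> C" if "Z k \<noteq> 0" for k
  proof -
    have "\<phi>h k * 1 \<le> \<phi>h k * real (Z k)" using that by (intro mult_left_mono) (auto simp: less_imp_le)
    also have "\<dots> \<le> C" using C(2)[of k] by simp
    finally show ?thesis by simp
  qed
  have "(\<Sum>l=1..Z k. (a k l)\<^sup>2) \<le> C * weight a k" for a k
  proof (cases "Z k = 0")
    case False
    have "(\<Sum>l=1..Z k. (a k l)\<^sup>2) = \<phi>h k * weight a k" by (simp add: weight_def)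
    also have "\<dots> \<le> C * weight a k" using le[OF False] by (intro mult_right_mono) auto
    finally show ?thesis .
  qed (simp add: weight_def)
  with C(1) le show ?thesis by (intro that[of C]) auto
qed

abbreviation L :: "((real ^ 'n) \<Rightarrow> real) \<Rightarrow> (real ^ 'n) \<Rightarrow> real" where
  "L \<equiv> integral_op \<omega> \<phi>"

text \<open>
  The value of $L_\phi f$ at $x$ is the integral of $f$ against the kernel at $x$, which is computed by
  integrating the expansion of the kernel termwise: $L_\phi$ multiplies the coefficients of degree $k$
  by $\hat\phi_k$.
\<close>

lemma
  assumes f: "f \<in> N"
  shows integral_op_mem: "L f \<in> N"
    and coeff_integral_op: "l \<in> {1..Z k} \<Longrightarrow> coeff (L f) k l = \<phi>h k * coeff f k l"
proof -
  let ?a = "\<lambda>k l. \<phi>h k * coeff f k l"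
  obtain C where C: "0 \<le> C" "\<forall>k. Z k \<noteq> 0 \<longrightarrow> \<phi>h k \<le> C"
    "\<forall>a k. (\<Sum>l=1..Z k. (a k l)\<^sup>2) \<le> C * weight a k" using spectrum_bounded .
  have a: "summable (weight ?a)"
  proof (rule summable_comparison_test'[of "\<lambda>k. C * C * weight (coeff f) k" 0])
    show "summable (\<lambda>k. C * C * weight (coeff f) k)" by (intro summable_mult native_memD f)
    fix k
    have "weight ?a k = \<phi>h k * \<phi>h k * weight (coeff f) k"
      by (simp add: weight_def power_mult_distrib power2_eq_square[of "\<phi>h k"] mult.assoc
        flip: sum_distrib_left)
    also have "\<dots> \<le> C * C * weight (coeff f) k"
    proof (cases "Z k = 0")
      case False
      then show ?thesis
        using C by (intro mult_right_mono mult_mono) (auto simp: less_imp_le)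
    qed (simp add: weight_def)
    finally show "norm (weight ?a k) \<le> C * C * weight (coeff f) k" by simp
  qed
  have F: "block ?a x sums L f x" if x: "x \<in> usphere" for x
  proof -
    have "(\<lambda>k. \<Sum>l=1..Z k. (\<phi>h k * Y k l x) * (LINT y|\<omega>. Y k l y * f y)) sums (LINT y|\<omega>. kernel_at x y * f y)"
      by (intro series_integral summable_weight_kernel kernel_at_sums bounded_measurable_native f x)
    moreover have "(LINT y|\<omega>. kernel_at x y * f y) = L f x"
      using x by (auto simp: integral_op_def sphere_fun_def kernel_at_def intro!: Bochner_Integration.integral_cong)
    moreover have "(\<Sum>l=1..Z k. (\<phi>h k * Y k l x) * (LINT y|\<omega>. Y k l y * f y)) = block ?a x k" for k
      by (simp add: block_def fcoeff_def mult_ac)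
    ultimately show ?thesis by simp
  qed
  show "L f \<in> N"
    by (rule native_memI[OF a F]) (simp_all add: integral_op_def sphere_fun_def)
  show "l \<in> {1..Z k} \<Longrightarrow> coeff (L f) k l = \<phi>h k * coeff f k l"
    by (rule coeff_series[OF a F])
qed

lemma nip_integral_op:
  assumes f: "f \<in> N" and g: "g \<in> N"
  shows "(\<lambda>k. \<Sum>l=1..Z k. coeff f k l * coeff g k l) sums nip (L f) g"
proof -
  have "inverse (\<phi>h k) * (\<Sum>l=1..Z k. coeff (L f) k l * coeff g k l) = (\<Sum>l=1..Z k. coeff f k l * coeff g k l)" for k
  proof -
    have "(\<Sum>l=1..Z k. coeff (L f) k l * coeff g k l) = (\<Sum>l=1..Z k. \<phi>h k * (coeff f k l * coeff g k l))"
      by (intro sum.cong refl) (simp add: coeff_integral_op f)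
    then show ?thesis by (simp flip: sum_distrib_left)
  qed
  then show ?thesis using nip_sums[OF integral_op_mem[OF f] g] by simp
qed

lemma nip_integral_op_self: "f \<in> N \<Longrightarrow> (\<lambda>k. \<Sum>l=1..Z k. (coeff f k l)\<^sup>2) sums nip (L f) f"
  using nip_integral_op[of f f] by (simp add: power2_eq_square)

lemma Parseval:
  assumes f: "f \<in> N"
  shows "nip (L f) f = (L2norm \<omega> f)\<^sup>2"
proof -
  have "(\<lambda>k. \<Sum>l=1..Z k. coeff f k l * (LINT x|\<omega>. Y k l x * f x)) sums (LINT x|\<omega>. f x * f x)"
    by (intro series_integral native_memD bounded_measurable_native f)
  then have "(\<lambda>k. \<Sum>l=1..Z k. coeff f k l * coeff f k l) sums (LINT x|\<omega>. f x * f x)"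
    by (simp add: fcoeff_def mult.commute)
  then have "nip (L f) f = (LINT x|\<omega>. f x * f x)"
    using nip_integral_op[OF f f] sums_unique2 by blast
  then show ?thesis by (simp add: L2norm_def power2_eq_square)
qed

lemma positive_integral_op: "positive_op N nip L"
proof -
  obtain C where C: "0 \<le> C" "\<forall>k. Z k \<noteq> 0 \<longrightarrow> \<phi>h k \<le> C"
    "\<forall>a k. (\<Sum>l=1..Z k. (a k l)\<^sup>2) \<le> C * weight a k" using spectrum_bounded .
  have "native.linear_op L"
    unfolding native.linear_op_def
  proof (intro conjI ballI allI integral_op_mem)
    fix f g and a b :: real assume fg: "f \<in> N" "g \<in> N"
    show "L (lincomb a f b g) = lincomb a (L f) b (L g)"
      using fg by (intro native_eqI)
        (simp_all add: integral_op_mem native_lincomb coeff_lincomb coeff_integral_op algebra_simps)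
  qed
  moreover have "nip (L f) g = nip f (L g)" if "f \<in> N" "g \<in> N" for f g
  proof -
    have "nip (L f) g = nip (L g) f"
      using nip_integral_op[OF that] nip_integral_op[OF that(2,1)] sums_unique2 by (simp add: mult.commute)
    then show ?thesis using that by (simp add: native.ip_commute integral_op_mem)
  qed
  ultimately have sym: "native.symmetric_op L" by (simp add: native.symmetric_op_def)
  show ?thesis
  proof (rule native.positive_opI[OF sym])
    fix f assume f: "f \<in> N"
    show "0 \<le> nip (L f) f" by (simp add: Parseval f)
    show "nip (L f) f \<le> C * nip f f"
      by (rule sums_le[OF _ nip_integral_op_self[OF f] sums_mult[OF weight_sums[OF f]]]) (rule C(3)[rule_format])
  qed
qed

lemma
  assumes x: "x ` {1..m} \<subseteq> usphere" and f: "f \<in> N"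
  shows discrete_op_mem: "discrete_op \<phi> m x w f \<in> N"
    and nip_discrete_op: "g \<in> N \<Longrightarrow>
      nip (discrete_op \<phi> m x w f) g = (\<Sum>i=1..m. w i * f (x i) * g (x i))"
proof -
  have eq: "discrete_op \<phi> m x w f = (\<lambda>y. \<Sum>i=1..m. (w i * f (x i)) * kernel_at (x i) y)"
    by (auto simp: discrete_op_def sphere_fun_def kernel_at_def fun_eq_iff)
  have x': "x i \<in> usphere" if "i \<in> {1..m}" for i using x that by blast
  show "discrete_op \<phi> m x w f \<in> N"
    unfolding eq by (intro native.sum_in_H kernel_at_mem x') auto
  show "nip (discrete_op \<phi> m x w f) g = (\<Sum>i=1..m. w i * f (x i) * g (x i))" if "g \<in> N"
  proof -
    have "nip (discrete_op \<phi> m x w f) g = (\<Sum>i=1..m. (w i * f (x i)) * nip (kernel_at (x i)) g)"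
      unfolding eq by (rule native.ip_sum_left[OF finite_atLeastAtMost kernel_at_mem[OF x'] that])
    also have "\<dots> = (\<Sum>i=1..m. w i * f (x i) * g (x i))"
      by (intro sum.cong refl arg_cong2[of _ _ _ _ "(*)"] reproducing[OF that x'])
    finally show ?thesis .
  qed
qed

lemma nip_discrete_op_self:
  assumes "x ` {1..m} \<subseteq> usphere" "f \<in> N" "\<forall>i\<in>{1..m}. w i > 0"
  shows "nip (discrete_op \<phi> m x w f) f = (discrete_norm m x w f)\<^sup>2"
proof -
  have "nip (discrete_op \<phi> m x w f) f = (\<Sum>i=1..m. w i * (f (x i))\<^sup>2)"
    using nip_discrete_op[OF assms(1,2,2), of w] by (simp add: power2_eq_square mult.assoc)
  moreover have "0 \<le> (\<Sum>i=1..m. w i * (f (x i))\<^sup>2)"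
    using assms(3) by (intro sum_nonneg mult_nonneg_nonneg) (auto simp: less_imp_le)
  ultimately show ?thesis by (simp add: discrete_norm_def)
qed

lemma positive_discrete_op:
  assumes x: "x ` {1..m} \<subseteq> usphere" and w: "\<forall>i\<in>{1..m}. w i > 0"
  shows "positive_op N nip (discrete_op \<phi> m x w)"
proof -
  let ?T = "discrete_op \<phi> m x w"
  have "?T (lincomb a f b g) = lincomb a (?T f) b (?T g)" for a b f g
    by (auto simp: discrete_op_def sphere_fun_def lincomb_def fun_eq_iff sum.distrib sum_distrib_left
      algebra_simps)
  then have "native.linear_op ?T"
    by (simp add: native.linear_op_def discrete_op_mem[OF x])
  moreover have "nip (?T f) g = nip f (?T g)" if "f \<in> N" "g \<in> N" for f g
    using nip_discrete_op[OF x that, of w] nip_discrete_op[OF x that(2,1), of w]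
      native.ip_commute[OF that(1) discrete_op_mem[OF x that(2), of w]]
    by (simp add: mult_ac)
  ultimately have sym: "native.symmetric_op ?T" by (simp add: native.symmetric_op_def)
  show ?thesis
  proof (rule native.positive_opI[OF sym])
    fix f assume f: "f \<in> N"
    show "0 \<le> nip (?T f) f" by (simp add: nip_discrete_op_self[OF x f w])
    have "nip (?T f) f = (\<Sum>i=1..m. w i * (f (x i))\<^sup>2)"
      using nip_discrete_op[OF x f f, of w] by (simp add: power2_eq_square mult.assoc)
    also have "\<dots> \<le> (\<Sum>i=1..m. w i * (\<phi> 1 * nip f f))"
    proof (intro sum_mono mult_left_mono native_pointwise_le f)
      fix i assume "i \<in> {1..m}"
      then show "x i \<in> usphere" "0 \<le> w i" using x w by (blast intro: less_imp_le)+
    qed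
    also have "\<dots> = ((\<Sum>i=1..m. w i) * \<phi> 1) * nip f f"
      by (simp add: sum_distrib_right mult.assoc)
    finally show "nip (?T f) f \<le> ((\<Sum>i=1..m. w i) * \<phi> 1) * nip f f" .
  qed
qed

lemma native_norm_eq: "native_norm \<omega> Z Y \<phi>h f = sqrt (nip f f)"
  by (simp add: native_norm_def native_inner_def power2_eq_square)

section \<open>The sampling inequalities\<close>

text \<open>
  In degree $k$ the claim is Young's inequality
  $(e\hat\phi_k)^{1-\beta}\lambda^\beta \le (1 - \beta)\,e\hat\phi_k + \beta\lambda$, multiplied by
  $\hat\phi_k^{-1}\sum_\ell \hat f_{k,\ell}^2$. The free constant $e$ is what turns into the power of
  $1 - c$.
\<close>

lemma interpolation_bound:
  assumes f: "f \<in> N" and \<beta>: "0 \<le> \<beta>" "\<beta> \<le> 1" and "e > 0" "lam > 0"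
  shows "summable (\<lambda>k. inverse (\<phi>h k powr \<beta>) * (\<Sum>l=1..Z k. (coeff f k l)\<^sup>2))"
    and "e powr (1 - \<beta>) * lam powr \<beta> * (\<Sum>k. inverse (\<phi>h k powr \<beta>) * (\<Sum>l=1..Z k. (coeff f k l)\<^sup>2))
      \<le> (1 - \<beta>) * e * nip (L f) f + \<beta> * lam * nip f f"
proof -
  let ?s = "\<lambda>k. \<Sum>l=1..Z k. (coeff f k l)\<^sup>2"
  let ?t = "\<lambda>k. (1 - \<beta>) * e * ?s k + \<beta> * lam * weight (coeff f) k"
  let ?K = "e powr (1 - \<beta>) * lam powr \<beta>"
  have K: "?K > 0" using assms by simp
  have t: "?t sums ((1 - \<beta>) * e * nip (L f) f + \<beta> * lam * nip f f)"
    by (intro sums_add sums_mult nip_integral_op_self weight_sums f)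
  have le: "?K * (inverse (\<phi>h k powr \<beta>) * ?s k) \<le> ?t k" for k
  proof -
    have "(e * \<phi>h k) powr (1 - \<beta>) * lam powr \<beta> \<le> (1 - \<beta>) * (e * \<phi>h k) + \<beta> * lam"
      using assms by (intro Youngs_inequality_0) auto
    moreover have "(e * \<phi>h k) powr (1 - \<beta>) = e powr (1 - \<beta>) * (\<phi>h k / \<phi>h k powr \<beta>)"
      using assms by (simp add: powr_mult powr_diff less_imp_le)
    ultimately have "?K * inverse (\<phi>h k powr \<beta>) * \<phi>h k \<le> (1 - \<beta>) * (e * \<phi>h k) + \<beta> * lam"
      by (simp add: field_simps)
    then have "?K * inverse (\<phi>h k powr \<beta>) * \<phi>h k * weight (coeff f) k \<le>
        ((1 - \<beta>) * (e * \<phi>h k) + \<beta> * lam) * weight (coeff f) k"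
      by (rule mult_right_mono) simp
    moreover have "\<phi>h k * weight (coeff f) k = ?s k" by (simp add: weight_def)
    ultimately show ?thesis by (simp add: ring_distribs mult.assoc)
  qed
  have s0: "0 \<le> inverse (\<phi>h k powr \<beta>) * ?s k" for k by (simp add: sum_nonneg)
  have sK: "summable (\<lambda>k. ?K * (inverse (\<phi>h k powr \<beta>) * ?s k))"
    by (rule summable_comparison_test'[OF sums_summable[OF t], of 0])
      (simp only: real_norm_def abs_of_nonneg[OF mult_nonneg_nonneg[OF less_imp_le[OF K] s0]] le)
  then show summ: "summable (\<lambda>k. inverse (\<phi>h k powr \<beta>) * ?s k)"
    using \<open>e > 0\<close> \<open>lam > 0\<close> by (simp add: summable_cmult_iff)
  have "(\<Sum>k. ?K * (inverse (\<phi>h k powr \<beta>) * ?s k)) \<le> (1 - \<beta>) * e * nip (L f) f + \<beta> * lam * nip f f"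
    using suminf_le[OF le sK sums_summable[OF t]] sums_unique[OF t] by simp
  then show "?K * (\<Sum>k. inverse (\<phi>h k powr \<beta>) * ?s k) \<le> (1 - \<beta>) * e * nip (L f) f + \<beta> * lam * nip f f"
    using suminf_mult[OF summ, of ?K] by simp
qed

end

lemma sqrt_sum_squares_le: "0 \<le> a \<Longrightarrow> 0 \<le> b \<Longrightarrow> sqrt (a\<^sup>2 + b\<^sup>2) \<le> a + b"
  by (intro real_le_lsqrt) (auto simp: power2_sum)

theorem proposition3p1:
  fixes d m :: nat
    and \<omega> :: "(real ^ 'n) measure"
    and Z :: "nat \<Rightarrow> nat"
    and Y :: "nat \<Rightarrow> nat \<Rightarrow> (real ^ 'n) \<Rightarrow> real"
    and \<phi> :: "real \<Rightarrow> real"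
    and \<phi>h \<psi>h :: "nat \<Rightarrow> real"
    and x :: "nat \<Rightarrow> real ^ 'n"
    and w :: "nat \<Rightarrow> real"
    and lam \<beta> c :: real
    and N :: "((real ^ 'n) \<Rightarrow> real) set"
    and ip :: "((real ^ 'n) \<Rightarrow> real) \<Rightarrow> ((real ^ 'n) \<Rightarrow> real) \<Rightarrow> real"
    and L L\<Lambda> :: "((real ^ 'n) \<Rightarrow> real) \<Rightarrow> (real ^ 'n) \<Rightarrow> real"
  assumes "d \<ge> 1" and "CARD('n) = d + 1"
    and "rotation_invariant_prob \<omega>"
    and "orthonormal_harmonic_bases \<omega> Z Y"
    and "spherical_basis_function Z Y \<phi> \<phi>h"
    and "inj_on x {1..m}" and "x ` {1..m} \<subseteq> usphere"
    and "\<forall>i\<in>{1..m}. w i > 0"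
    and "lam > 0"
    and "0 \<le> \<beta>" and "\<beta> \<le> 1" and "\<psi>h = (\<lambda>k. \<phi>h k powr \<beta>)"
    and "N = native_fun \<omega> Z Y \<phi>h"
    and "ip = native_inner \<omega> Z Y \<phi>h"
    and "L = integral_op \<omega> \<phi>"
    and "L\<Lambda> = discrete_op \<phi> m x w"
    and "c > 0" and "c < 1 / 2"
    and "op_norm N ip (op_inv_sqrt N ip (op_shift L lam) \<circ> op_diff L L\<Lambda> \<circ>
           op_inv_sqrt N ip (op_shift L lam)) \<le> ennreal c"
  shows "op_norm N ip (op_sqrt N ip (op_shift L lam) \<circ> op_inv_sqrt N ip (op_shift L\<Lambda> lam))
           \<le> ennreal (sqrt (1 / (1 - c)))
       \<and> op_norm N ip (op_inv_sqrt N ip (op_shift L lam) \<circ> op_sqrt N ip (op_shift L\<Lambda> lam))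
           \<le> ennreal (sqrt ((1 - c) / (1 - 2 * c)))
       \<and> (\<forall>f\<in>N.
            f \<in> native_L2 \<omega> Z Y \<psi>h \<and>
            native_norm \<omega> Z Y \<psi>h f
              \<le> 1 / (1 - c) powr ((1 - \<beta>) / 2) * lam powr (- \<beta> / 2) *
                 (sqrt lam * native_norm \<omega> Z Y \<phi>h f + discrete_norm m x w f))
       \<and> (\<forall>f\<in>N.
            discrete_norm m x w f
              \<le> sqrt ((1 - c) / (1 - 2 * c)) *
                 (L2norm \<omega> f + sqrt lam * native_norm \<omega> Z Y \<phi>h f))"
proof -
  interpret spherical_kernel \<omega> Z Y \<phi> \<phi>h
    using assms(1-5) by unfold_locales auto
  note N = \<open>N = native_fun \<omega> Z Y \<phi>h\<close> and ip = \<open>ip = native_inner \<omega> Z Y \<phi>h\<close>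
  interpret hilbert: function_hilbert_space N ip
    unfolding N ip by (rule native.function_hilbert_space_axioms)
  have L: "positive_op N ip L"
    unfolding N ip \<open>L = integral_op \<omega> \<phi>\<close> by (rule positive_integral_op)
  have L\<Lambda>: "positive_op N ip L\<Lambda>"
    unfolding N ip \<open>L\<Lambda> = discrete_op \<phi> m x w\<close> using assms by (intro positive_discrete_op)
  define A where "A = op_shift L lam"
  define B where "B = op_shift L\<Lambda> lam"
  have A: "hilbert.coercive_op A" and B: "hilbert.coercive_op B"
    unfolding A_def B_def using L L\<Lambda> \<open>lam > 0\<close> by (auto intro: hilbert.coercive_op_shift)
  have X: "ip (L f) f = (L2norm \<omega> f)\<^sup>2" and D: "ip (L\<Lambda> f) f = (discrete_norm m x w f)\<^sup>2"
    and V: "ip f f = (native_norm \<omega> Z Y \<phi>h f)\<^sup>2" if "f \<in> N" for f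
    using that hilbert.ip_nonneg[OF that] Parseval[of f] nip_discrete_op_self[of x m f w] assms(7,8)
    by (simp_all add: N ip \<open>L = _\<close> \<open>L\<Lambda> = _\<close> native_norm_eq)
  have nonneg: "0 \<le> L2norm \<omega> f" "0 \<le> discrete_norm m x w f" "0 \<le> native_norm \<omega> Z Y \<phi>h f"
    if "f \<in> N" for f
  proof -
    show "0 \<le> L2norm \<omega> f" by (simp add: L2norm_def)
    show "0 \<le> discrete_norm m x w f"
      using assms(8) by (auto simp: discrete_norm_def less_imp_le intro!: sum_nonneg)
    show "0 \<le> native_norm \<omega> Z Y \<phi>h f"
      using hilbert.ip_nonneg[OF that] by (simp add: native_norm_eq ip)
  qed
  have AB: "\<bar>ip (A f) f - ip (B f) f\<bar> \<le> c * ip (A f) f" if f: "f \<in> N" for f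
  proof -
    note lin = hilbert.symmetric_op_linear[OF hilbert.positive_op_symmetric]
    have "\<bar>ip (op_diff L L\<Lambda> f) f\<bar> \<le> c * ip (A f) f"
      using assms(17,19) unfolding A_def[symmetric]
      by (intro hilbert.form_bound_if_sandwiched_norm[OF A] hilbert.linear_op_diff lin L L\<Lambda> f) auto
    moreover have "op_diff L L\<Lambda> f = lincomb 1 (L f) (-1) (L\<Lambda> f)"
      by (simp add: op_diff_def lincomb_def)
    then have "ip (op_diff L L\<Lambda> f) f = ip (A f) f - ip (B f) f"
      using hilbert.linear_op_mem[OF lin[OF L] f] hilbert.linear_op_mem[OF lin[OF L\<Lambda>] f] f
      by (simp add: A_def B_def hilbert.ip_op_shift L L\<Lambda>)
    ultimately show ?thesis by simp
  qed
  have frac: "1 + c \<le> (1 - c) / (1 - 2 * c)"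
    using \<open>c > 0\<close> \<open>c < 1 / 2\<close> by (simp add: field_simps)
  have le1: "ip (A f) f \<le> 1 / (1 - c) * ip (B f) f" if "f \<in> N" for f
    using AB[OF that] \<open>c < 1 / 2\<close> by (simp add: field_simps)
  have le2: "ip (B f) f \<le> (1 - c) / (1 - 2 * c) * ip (A f) f" if "f \<in> N" for f
  proof -
    have "ip (B f) f \<le> (1 + c) * ip (A f) f" using AB[OF that] by (simp add: algebra_simps)
    also have "\<dots> \<le> (1 - c) / (1 - 2 * c) * ip (A f) f"
      by (intro mult_right_mono frac hilbert.coercive_op_nonneg[OF A that])
    finally show ?thesis .
  qed
  have Aip: "ip (A f) f = (L2norm \<omega> f)\<^sup>2 + lam * (native_norm \<omega> Z Y \<phi>h f)\<^sup>2"
    and Bip: "ip (B f) f = (discrete_norm m x w f)\<^sup>2 + lam * (native_norm \<omega> Z Y \<phi>h f)\<^sup>2" if "f \<in> N" for f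
    using X[OF that] D[OF that] V[OF that] by (simp_all add: A_def B_def hilbert.ip_op_shift L L\<Lambda> that)
  have sq: "lam * (native_norm \<omega> Z Y \<phi>h f)\<^sup>2 = (sqrt lam * native_norm \<omega> Z Y \<phi>h f)\<^sup>2" for f
    using \<open>lam > 0\<close> by (simp add: power_mult_distrib)
  have "op_norm N ip (op_sqrt N ip A \<circ> op_inv_sqrt N ip B) \<le> ennreal (sqrt (1 / (1 - c)))"
    using \<open>c < 1 / 2\<close> by (intro hilbert.op_norm_sqrt_inv_sqrt_le A B le1) auto
  moreover have "op_norm N ip (op_inv_sqrt N ip A \<circ> op_sqrt N ip B) \<le> ennreal (sqrt ((1 - c) / (1 - 2 * c)))"
    using \<open>c < 1 / 2\<close> by (intro hilbert.op_norm_inv_sqrt_sqrt_le A B le2) auto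
  moreover have "f \<in> native_L2 \<omega> Z Y \<psi>h \<and>
      native_norm \<omega> Z Y \<psi>h f \<le> 1 / (1 - c) powr ((1 - \<beta>) / 2) * lam powr (- \<beta> / 2) *
        (sqrt lam * native_norm \<omega> Z Y \<phi>h f + discrete_norm m x w f)" if f: "f \<in> N" for f
  proof
    define e where "e = 1 - c"
    have e: "e > 0" "e \<le> 1" using \<open>c > 0\<close> \<open>c < 1 / 2\<close> by (simp_all add: e_def)
    define P where "P = (\<Sum>k. inverse (\<psi>h k) * (\<Sum>l=1..Z k. (coeff f k l)\<^sup>2))"
    note bound = interpolation_bound[OF f[unfolded N] \<open>0 \<le> \<beta>\<close> \<open>\<beta> \<le> 1\<close> e(1) \<open>lam > 0\<close>]
    show "f \<in> native_L2 \<omega> Z Y \<psi>h"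
      using f bound(1) unfolding N native_fun_def native_L2_def by (simp add: \<open>\<psi>h = _\<close>)
    have "e powr (1 - \<beta>) * lam powr \<beta> * P \<le> (1 - \<beta>) * (e * ip (L f) f) + \<beta> * (lam * ip f f)"
      using bound(2) by (simp add: P_def \<open>\<psi>h = _\<close> \<open>L = _\<close> ip mult.assoc)
    also have "\<dots> \<le> (1 - \<beta>) * ip (B f) f + \<beta> * ip (B f) f"
    proof (intro add_mono mult_left_mono)
      \<comment> \<open>The part $e\lambda\langle f, f\rangle$ of $e\langle Af, f\rangle$ is discarded.\<close>
      have "e * ip (A f) f \<le> ip (B f) f"
        using AB[OF f] by (simp add: e_def algebra_simps)
      moreover have "0 \<le> e * (lam * ip f f)" using e \<open>lam > 0\<close> f by simp
      ultimately show "e * ip (L f) f \<le> ip (B f) f"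
        using Aip[OF f] X[OF f] V[OF f] by (simp add: ring_distribs)
      show "lam * ip f f \<le> ip (B f) f" using Bip[OF f] V[OF f] by simp
    qed (use \<open>0 \<le> \<beta>\<close> \<open>\<beta> \<le> 1\<close> in auto)
    also have "\<dots> = ip (B f) f" by (simp add: algebra_simps)
    finally have "P \<le> ip (B f) f / (e powr (1 - \<beta>) * lam powr \<beta>)"
      using e \<open>lam > 0\<close> by (simp add: field_simps)
    then have "sqrt P \<le> sqrt (ip (B f) f / (e powr (1 - \<beta>) * lam powr \<beta>))"
      by (rule real_sqrt_le_mono)
    also have "\<dots> = 1 / e powr ((1 - \<beta>) / 2) * lam powr (- \<beta> / 2) * sqrt (ip (B f) f)"
    proof -
      have "sqrt (t powr s) = t powr (s / 2)" if "t > 0" for t s :: real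
        using that by (simp add: powr_half_sqrt[symmetric] powr_powr)
      then show ?thesis
        using e \<open>lam > 0\<close> by (simp add: real_sqrt_divide real_sqrt_mult powr_minus field_simps)
    qed
    also have "\<dots> \<le> 1 / e powr ((1 - \<beta>) / 2) * lam powr (- \<beta> / 2) *
        (sqrt lam * native_norm \<omega> Z Y \<phi>h f + discrete_norm m x w f)"
    proof (rule mult_left_mono)
      have "sqrt (ip (B f) f) \<le> discrete_norm m x w f + sqrt lam * native_norm \<omega> Z Y \<phi>h f"
        unfolding Bip[OF f] sq using nonneg[OF f] \<open>lam > 0\<close> by (intro sqrt_sum_squares_le) auto
      then show "sqrt (ip (B f) f) \<le> sqrt lam * native_norm \<omega> Z Y \<phi>h f + discrete_norm m x w f"
        by simp
    qed (use e in simp)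
    finally show "native_norm \<omega> Z Y \<psi>h f \<le> 1 / (1 - c) powr ((1 - \<beta>) / 2) * lam powr (- \<beta> / 2) *
        (sqrt lam * native_norm \<omega> Z Y \<phi>h f + discrete_norm m x w f)"
      by (simp add: native_norm_def P_def e_def)
  qed
  moreover have "discrete_norm m x w f \<le> sqrt ((1 - c) / (1 - 2 * c)) *
      (L2norm \<omega> f + sqrt lam * native_norm \<omega> Z Y \<phi>h f)" if f: "f \<in> N" for f
  proof -
    have "(discrete_norm m x w f)\<^sup>2 \<le> ip (B f) f" using Bip[OF f] \<open>lam > 0\<close> by simp
    also have "\<dots> \<le> (1 - c) / (1 - 2 * c) * ip (A f) f" by (rule le2[OF f])
    finally have "sqrt ((discrete_norm m x w f)\<^sup>2) \<le> sqrt ((1 - c) / (1 - 2 * c) * ip (A f) f)"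
      by (rule real_sqrt_le_mono)
    then have "discrete_norm m x w f \<le> sqrt ((1 - c) / (1 - 2 * c)) * sqrt (ip (A f) f)"
      using nonneg(2)[OF f] by (simp only: real_sqrt_mult real_sqrt_abs abs_of_nonneg)
    also have "\<dots> \<le> sqrt ((1 - c) / (1 - 2 * c)) * (L2norm \<omega> f + sqrt lam * native_norm \<omega> Z Y \<phi>h f)"
    proof (rule mult_left_mono)
      show "sqrt (ip (A f) f) \<le> L2norm \<omega> f + sqrt lam * native_norm \<omega> Z Y \<phi>h f"
        unfolding Aip[OF f] sq using nonneg[OF f] \<open>lam > 0\<close> by (intro sqrt_sum_squares_le) auto
    qed (use \<open>c < 1 / 2\<close> in simp)
    finally show ?thesis .
  qed
  ultimately show ?thesis unfolding A_def B_def by blast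
qed

end
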